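(* Let $D, D' \subset \mathbb{C}$ be bounded domains and let $p \in \partial D$ be a $C^2$-smooth boundary point of $D$. Then the Aumann–Carathéodory rigidity constant satisfies $\Omega(D, z) \to 1$ as $z \to p$, $z \in D$. Furthermore, for every fixed $w \in D'$, $\Omega(z, w) \to 1$ as $z \to p$, $z \in D$.
   Context: $C^2$-smooth boundary point $p\in\partial D$: there are a neighbourhood $U$ of $p$ and a $C^2$-smooth function $\psi : U \to \mathbb{R}$ with $U \cap D = \{\psi<0\}$, $U \cap \partial D = \{\psi = 0\}$ and $d\psi \ne 0$ on $U \cap \partial D$. $\lambda_D(z)|dz|$ is the hyperbolic metric of a bounded domain $D$, normalized by $\lambda_{\mathbb{D}}(z) = 1/(1-|z|^2)$ on the unit disc $\mathbb{D}$ (so $\lambda_D(a) = 1/|\pi'(0)|$ for any holomorphic universal covering $\pi : \mathbb{D} \to D$ with $\pi(0)=a$). Aumann–Carathéodory rigidity constant: for $a \in D$, $\Omega(D,a)$ is the smallest constant such that $|f'(a)| \le \Omega(D,a)$ for every holomorphic $f : D \to D$ with $f(a) = a$ which is not an automorphism of $D$; that is, $\Omega(D,a)=\sup |f'(a)|$ over all such $f$. For $a\in D$, $b \in D'$: $\Omega(a,b) = \sup\left\{ \dfrac{\lambda_{D'}(b)\,|f'(a)|}{\lambda_D(a)} : f \in \mathcal{N}(D,D'),\ f(a) = b\right\}$, where $\mathcal{N}(D,D')$ is the class of holomorphic maps $f : D \to D'$ that are not coverings. *)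

theory Defs
  imports "HOL-Complex_Analysis.Complex_Analysis"
begin

text \<open>
  \<open>C\<^sup>2\<close>-smoothness on \<open>U\<close> in the real sense: the first and second derivatives are maps into
  spaces of bounded linear functions, and the second derivative is continuous.  Intended
  for open \<open>U\<close>.
\<close>

definition C2_on :: "'a::real_normed_vector set \<Rightarrow> ('a \<Rightarrow> 'b::real_normed_vector) \<Rightarrow> bool" where
  "C2_on U f \<longleftrightarrow>
     (\<exists>(f' :: 'a \<Rightarrow> 'a \<Rightarrow>\<^sub>L 'b) (f'' :: 'a \<Rightarrow> 'a \<Rightarrow>\<^sub>L 'a \<Rightarrow>\<^sub>L 'b).
        (\<forall>x\<in>U. (f has_derivative blinfun_apply (f' x)) (at x)) \<and>
        (\<forall>x\<in>U. (f' has_derivative blinfun_apply (f'' x)) (at x)) \<and>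
        continuous_on U f'')"

definition C2_boundary_point :: "complex set \<Rightarrow> complex \<Rightarrow> bool" where
  "C2_boundary_point D p \<longleftrightarrow>
     p \<in> frontier D \<and>
     (\<exists>U (\<psi> :: complex \<Rightarrow> real).
        open U \<and> p \<in> U \<and> C2_on U \<psi> \<and>
        U \<inter> D = {z \<in> U. \<psi> z < 0} \<and>
        U \<inter> frontier D = {z \<in> U. \<psi> z = 0} \<and>
        (\<forall>z \<in> U \<inter> frontier D. frechet_derivative \<psi> (at z) \<noteq> (\<lambda>_. 0)))"

text \<open>
  A covering of \<open>D\<close> by the disc is universal since the disc is simply connected.
\<close>

definition holomorphic_universal_covering :: "complex set \<Rightarrow> (complex \<Rightarrow> complex) \<Rightarrow> bool" where
  "holomorphic_universal_covering D \<pi> \<longleftrightarrow>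
     \<pi> holomorphic_on ball 0 1 \<and> covering_space (ball 0 1) \<pi> D"

text \<open>
  The density of the hyperbolic metric, normalised to be \<open>1 / (1 - |z|\<^sup>2)\<close> on the unit disc.
  The value does not depend on \<open>\<pi>\<close>: two choices differ by a rotation of the disc.
\<close>

definition hyperbolic_density :: "complex set \<Rightarrow> complex \<Rightarrow> real" where
  "hyperbolic_density D a =
     (THE l. \<exists>\<pi>. holomorphic_universal_covering D \<pi> \<and> \<pi> 0 = a \<and> l = 1 / cmod (deriv \<pi> 0))"

definition holomorphic_automorphism :: "complex set \<Rightarrow> (complex \<Rightarrow> complex) \<Rightarrow> bool" where
  "holomorphic_automorphism D f \<longleftrightarrow>
     (\<exists>g. f holomorphic_on D \<and> g holomorphic_on D \<and> homeomorphism D D f g)"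

text \<open>
  For bounded \<open>D\<close> and \<open>a \<in> D\<close> the supremum is over a set of reals that is bounded (by Cauchy's
  estimate) and nonempty (it contains the constant map \<open>a\<close>).
\<close>

definition rigidity_const :: "complex set \<Rightarrow> complex \<Rightarrow> real" where
  "rigidity_const D a =
     Sup {cmod (deriv f a) | f.
            f holomorphic_on D \<and> f ` D \<subseteq> D \<and> f a = a \<and> \<not> holomorphic_automorphism D f}"

definition noncovering_maps :: "complex set \<Rightarrow> complex set \<Rightarrow> (complex \<Rightarrow> complex) set" where
  "noncovering_maps D D' =
     {f. f holomorphic_on D \<and> f ` D \<subseteq> D' \<and> \<not> covering_space D f D'}"

definition rigidity_const2 ::
  "complex set \<Rightarrow> complex set \<Rightarrow> complex \<Rightarrow> complex \<Rightarrow> real" where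
  "rigidity_const2 D D' a b =
     Sup {hyperbolic_density D' b * cmod (deriv f a) / hyperbolic_density D a | f.
            f \<in> noncovering_maps D D' \<and> f a = b}"

end

theory Submission
  imports Defs
begin

text \<open>
  Let \<open>q\<close> be the boundary point nearest to \<open>z\<close> and \<open>t = |z - q|\<close>.  Smoothness gives discs of a
  uniform radius \<open>r\<close> tangent to the boundary at \<open>q\<close> from both sides, so \<open>D\<close> lies between an
  inner disc and the exterior of an outer disc whose hyperbolic densities at \<open>z\<close> have ratio
  \<open>(2 r - t) / (2 r + t)\<close>, which tends to \<open>1\<close>.  Mapping the exterior of the outer disc to the unit
  disc, shrinking slightly, and then mapping to the inner disc (or to \<open>D'\<close> by its universal
  covering) gives maps with relatively compact image that almost attain the trivial upper
  bound \<open>1\<close> coming from the Schwarz--Pick lemma.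

  The Schwarz--Pick lemma needs the universal covering of a bounded domain \<open>D\<close>, which is obtained
  by Koebe's osculation.  Among all coverings \<open>h\<close> of \<open>D\<close> by open subsets of the unit disc, with
  \<open>h 0 = a\<close>, taking a square root at a point \<open>b\<close> of the disc that is missed decreases \<open>|h' 0|\<close> by
  the factor \<open>2 \<surd>|b| / (1 + |b|)\<close>.  Hence a sequence with \<open>|h' 0|\<close> tending to its positive infimum
  has domains exhausting the disc, and a subsequence converges to a covering by the whole disc.
\<close>

subsection \<open>Coverings described by sections over discs\<close>

text \<open>
  Unlike being a covering, the existence of a section through every point over every disc of
  \<open>D\<close> passes at once to composites with a square root and to locally uniform limits.
\<close>

definition disc_sections :: "complex set \<Rightarrow> (complex \<Rightarrow> complex) \<Rightarrow> complex set \<Rightarrow> bool" where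
  "disc_sections V h D \<longleftrightarrow>
     (\<forall>z\<in>V. \<forall>w s. ball w s \<subseteq> D \<longrightarrow> h z \<in> ball w s \<longrightarrow>
        (\<exists>g. g holomorphic_on ball w s \<and> g ` ball w s \<subseteq> V \<and> g (h z) = z \<and>
             (\<forall>u\<in>ball w s. h (g u) = u)))"

lemma disc_sectionsE:
  assumes "disc_sections V h D" "z \<in> V" "ball w s \<subseteq> D" "h z \<in> ball w s"
  obtains g where "g holomorphic_on ball w s" "\<And>u. u \<in> ball w s \<Longrightarrow> g u \<in> V" "g (h z) = z"
    "\<And>u. u \<in> ball w s \<Longrightarrow> h (g u) = u"
proof -
  have "\<exists>g. g holomorphic_on ball w s \<and> g ` ball w s \<subseteq> V \<and> g (h z) = z \<and> (\<forall>u\<in>ball w s. h (g u) = u)"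
    using assms unfolding disc_sections_def by blast
  then show thesis using that by blast
qed

lemma open_image_section:
  assumes "g holomorphic_on T" "open T" "\<And>u. u \<in> T \<Longrightarrow> h (g u) = u"
  shows "open (g ` T)"
  by (rule open_mapping_thm3[OF assms(1,2)], rule inj_on_inverseI[of _ h], rule assms(3))

lemma section_unique:
  assumes g1: "g1 holomorphic_on T" "\<And>u. u \<in> T \<Longrightarrow> h (g1 u) = u"
    and g2: "g2 holomorphic_on T" "\<And>u. u \<in> T \<Longrightarrow> h (g2 u) = u"
    and T: "open T" "connected T" and x: "x \<in> T" "g1 x = g2 x" and u: "u \<in> T"
  shows "g1 u = g2 u"
proof -
  let ?E = "{v \<in> T. g1 v - g2 v = 0}"
  have c: "continuous_on T g1" "continuous_on T g2"
    using g1 g2 by (auto intro: holomorphic_on_imp_continuous_on)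
  have "?E = T \<inter> g2 -` (g1 ` T)"
  proof (intro equalityI subsetI)
    fix v assume "v \<in> T \<inter> g2 -` (g1 ` T)"
    then obtain v' where "v \<in> T" "v' \<in> T" "g2 v = g1 v'" by auto
    then show "v \<in> ?E" using g1(2) g2(2) by (metis (mono_tags, lifting) mem_Collect_eq right_minus_eq)
  qed (auto intro: image_eqI[OF sym])
  then have "openin (top_of_set T) ?E"
    using c(2) open_image_section[OF g1(1) T(1) g1(2)] continuous_openin_preimage_gen by metis
  moreover have "closedin (top_of_set T) ?E"
    using c by (intro continuous_closedin_preimage_constant continuous_intros)
  ultimately have "?E = {} \<or> ?E = T"
    using T(2) connected_clopen by blast
  with x u show ?thesis by auto
qed

lemma covering_space_if_disc_sections:
  assumes V: "V \<noteq> {}" and h: "h holomorphic_on V" "h ` V \<subseteq> D"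
    and D: "open D" "connected D" and sec: "disc_sections V h D"
  shows "covering_space V h D"
proof -
  have contV: "continuous_on V h" by (simp add: h holomorphic_on_imp_continuous_on)
  have reach: "ball w s \<subseteq> h ` V" if B: "ball w s \<subseteq> D" "z \<in> V" "h z \<in> ball w s" for w s z
  proof -
    obtain g where "\<And>u. u \<in> ball w s \<Longrightarrow> g u \<in> V" "\<And>u. u \<in> ball w s \<Longrightarrow> h (g u) = u"
      using disc_sectionsE[OF sec B(2,1,3)] by metis
    then show ?thesis by force
  qed
  have "open (h ` V)"
    unfolding open_contains_ball
  proof
    fix y assume "y \<in> h ` V"
    then obtain z e where "z \<in> V" "y = h z" "e > 0" "ball y e \<subseteq> D"
      using D(1) h(2) open_contains_ball by (metis image_subset_iff imageE)
    then show "\<exists>e>0. ball y e \<subseteq> h ` V" using reach[of y e z] by auto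
  qed
  moreover have "openin (top_of_set D) (D - h ` V)"
  proof -
    have "open (D - h ` V)"
      unfolding open_contains_ball
    proof
      fix y assume y: "y \<in> D - h ` V"
      then obtain e where e: "e > 0" "ball y e \<subseteq> D" using D(1) open_contains_ball by blast
      have "ball y e \<inter> h ` V = {}"
      proof (rule ccontr)
        assume "\<not> ?thesis"
        then obtain z where "z \<in> V" "h z \<in> ball y e" by auto
        then have "y \<in> h ` V" using reach[of y e z] e by auto
        then show False using y by auto
      qed
      then show "\<exists>e>0. ball y e \<subseteq> D - h ` V" using e by blast
    qed
    then show ?thesis by (simp add: open_subset)
  qed
  then have "closedin (top_of_set D) (h ` V)"
    using h(2) by (simp add: closedin_def)
  ultimately have surj: "h ` V = D"
    using D(2) V h(2) connected_clopen[of D] open_subset by blast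
  show ?thesis
    unfolding covering_space_def
  proof (intro conjI ballI contV surj)
    fix x assume "x \<in> D"
    then obtain e where e: "e > 0" "ball x e \<subseteq> D" using D(1) open_contains_ball by blast
    define T where "T = ball x e"
    define G where "G = {g. g holomorphic_on T \<and> g ` T \<subseteq> V \<and> (\<forall>u\<in>T. h (g u) = u)}"
    have oT: "open T" "connected T" by (auto simp: T_def)
    have opn: "open (g ` T)" if "g \<in> G" for g
      using that open_image_section[of g T h] oT by (auto simp: G_def)
    show "\<exists>T. x \<in> T \<and> openin (top_of_set D) T \<and>
             (\<exists>v. \<Union> v = V \<inter> h -` T \<and> (\<forall>u\<in>v. openin (top_of_set V) u) \<and>
                  pairwise disjnt v \<and> (\<forall>u\<in>v. \<exists>q. homeomorphism u T h q))"
    proof (rule exI[of _ T], intro conjI exI[of _ "(\<lambda>g. g ` T) ` G"] ballI)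
      show "x \<in> T" "openin (top_of_set D) T" using e by (auto simp: T_def open_subset)
      have "z \<in> \<Union> ((\<lambda>g. g ` T) ` G)" if z: "z \<in> V" "h z \<in> T" for z
      proof -
        obtain g where "g holomorphic_on T" "\<And>u. u \<in> T \<Longrightarrow> g u \<in> V" "g (h z) = z"
            "\<And>u. u \<in> T \<Longrightarrow> h (g u) = u"
          using disc_sectionsE[OF sec z(1) e(2)] z unfolding T_def by metis
        then have "g \<in> G" "z \<in> g ` T" using z by (auto simp: G_def image_iff) metis
        then show ?thesis by blast
      qed
      then show "\<Union> ((\<lambda>g. g ` T) ` G) = V \<inter> h -` T" by (auto simp: G_def)
      show "openin (top_of_set V) u" if "u \<in> (\<lambda>g. g ` T) ` G" for u
        using that opn by (auto simp: G_def intro!: open_subset)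
      show "\<exists>q. homeomorphism u T h q" if u: "u \<in> (\<lambda>g. g ` T) ` G" for u
      proof -
        obtain g where g: "g \<in> G" "u = g ` T" using u by blast
        then have "homeomorphism u T h g"
          unfolding homeomorphism_def G_def
          by (auto intro: continuous_on_subset[OF contV] holomorphic_on_imp_continuous_on simp: image_image)
        then show ?thesis by blast
      qed
      show "pairwise disjnt ((\<lambda>g. g ` T) ` G)"
      proof (clarsimp simp: pairwise_def)
        fix g1 g2 assume g: "g1 \<in> G" "g2 \<in> G" and ne: "g1 ` T \<noteq> g2 ` T"
        show "disjnt (g1 ` T) (g2 ` T)"
        proof (rule ccontr)
          assume "\<not> ?thesis"
          then obtain y where "y \<in> g1 ` T" "y \<in> g2 ` T" unfolding disjnt_def by blast
          then obtain u1 u2 where u: "u1 \<in> T" "u2 \<in> T" "g1 u1 = g2 u2" by (metis imageE)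
          have s: "h (g1 v) = v" "h (g2 v) = v" if "v \<in> T" for v
            using g that by (auto simp: G_def)
          have "u1 = u2" using s(1)[OF u(1)] s(2)[OF u(2)] u(3) by simp
          then have "g1 v = g2 v" if "v \<in> T" for v
            using section_unique[of g1 T h g2 u1 v] g u(1,3) that oT s by (auto simp: G_def)
          then have "g1 ` T = g2 ` T" by (intro image_cong) auto
          then show False using ne by simp
        qed
      qed
    qed
  qed
qed

subsection \<open>Existence of the universal covering of a bounded domain\<close>

definition pointed_cover ::
  "complex set \<Rightarrow> complex \<Rightarrow> complex set \<Rightarrow> (complex \<Rightarrow> complex) \<Rightarrow> bool" where
  "pointed_cover D a V h \<longleftrightarrow>
     open V \<and> V \<subseteq> ball 0 1 \<and> 0 \<in> V \<and> h holomorphic_on V \<and> h ` V \<subseteq> D \<and> h 0 = a \<and> disc_sections V h D"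

lemma pointed_cover_exists:
  assumes D: "open D" "bounded D" and a: "a \<in> D"
  shows "\<exists>V h. pointed_cover D a V h"
proof -
  obtain R where R: "R > 0" "D \<subseteq> ball a R"
    using bounded_subset_ballD[OF D(2)] by blast
  define h where "h = (\<lambda>u. a + of_real R * u)"
  define k where "k = (\<lambda>u. (u - a) / of_real R)"
  have hk: "h (k u) = u" "k (h u) = u" for u using R by (auto simp: h_def k_def)
  have hol: "h holomorphic_on X" "k holomorphic_on X" for X
    unfolding h_def k_def by (intro holomorphic_intros; use R in simp)+
  have k0: "k a = 0" "h 0 = a" by (auto simp: h_def k_def)
  have "k ` D = h -` D" using hk by (auto simp: image_iff) metis
  moreover have "open (h -` D)"
    using D(1) hol(1)[of UNIV] by (simp add: holomorphic_on_imp_continuous_on open_vimage)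
  moreover have "k u \<in> ball 0 1" if "u \<in> D" for u
    using R that by (auto simp: k_def norm_divide dist_norm norm_minus_commute divide_simps)
  moreover have "disc_sections (k ` D) h D"
    unfolding disc_sections_def
  proof (intro ballI allI impI)
    fix z w s assume "ball w s \<subseteq> D"
    then show "\<exists>g. g holomorphic_on ball w s \<and> g ` ball w s \<subseteq> k ` D \<and> g (h z) = z \<and>
               (\<forall>u\<in>ball w s. h (g u) = u)"
      using hol hk by (intro exI[of _ k]) auto
  qed
  ultimately have "pointed_cover D a (k ` D) h"
    unfolding pointed_cover_def using a hol hk k0 by (force simp: image_subset_iff)
  then show ?thesis by blast
qed

lemma cmod_deriv_le_if_bounded_on_ball:
  assumes "f holomorphic_on ball z r" "\<And>u. u \<in> ball z r \<Longrightarrow> cmod (f u) \<le> B" "r > 0"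
  shows "cmod (deriv f z) \<le> B / r"
proof -
  have *: "cmod (deriv f z) \<le> (B + e) / (r - e)" if e: "e > 0" "e < r" for e
  proof -
    have "cmod ((deriv ^^ 1) f z) \<le> fact 1 * (B + e) / (r - e) ^ 1"
    proof (rule Cauchy_higher_deriv_bound)
      have "cball z (r - e) \<subseteq> ball z r" using e by auto
      then show "f holomorphic_on ball z (r - e)" "continuous_on (cball z (r - e)) f"
        using assms(1) e by (meson ball_subset_cball holomorphic_on_subset order_trans
              holomorphic_on_imp_continuous_on)+
      show "f w \<in> ball 0 (B + e)" if "w \<in> ball z (r - e)" for w
        using assms(2)[of w] that e by auto
    qed (use e in auto)
    then show ?thesis by simp
  qed
  have "((\<lambda>e. (B + e) / (r - e)) \<longlongrightarrow> (B + 0) / (r - 0)) (at_right 0)"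
    using assms(3) by (intro tendsto_intros) auto
  moreover have "\<forall>\<^sub>F e in at_right 0. cmod (deriv f z) \<le> (B + e) / (r - e)"
    using eventually_at_right_less[of 0] eventually_at_right_real[OF assms(3)]
    by eventually_elim (use * in auto)
  ultimately show ?thesis
    by (intro tendsto_lowerbound[where F = "at_right 0"]) auto
qed

lemma pointed_cover_deriv_ge:
  assumes pc: "pointed_cover D a V h" and r: "r > 0" "ball a r \<subseteq> D"
  shows "cmod (deriv h 0) \<ge> r"
proof -
  have V: "open V" "V \<subseteq> ball 0 1" "0 \<in> V" "h holomorphic_on V" "h 0 = a" "disc_sections V h D"
    using pc by (auto simp: pointed_cover_def)
  then obtain g where g: "g holomorphic_on ball a r" "\<And>u. u \<in> ball a r \<Longrightarrow> g u \<in> V" "g a = 0"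
      "\<And>u. u \<in> ball a r \<Longrightarrow> h (g u) = u"
    using r by (metis centre_in_ball disc_sectionsE)
  have "cmod (deriv g a) \<le> 1 / r"
    using g(2) V(2) r by (intro cmod_deriv_le_if_bounded_on_ball[OF g(1)]) fastforce+
  moreover have "deriv (h \<circ> g) a = deriv h 0 * deriv g a"
    using V g r by (subst deriv_chain)
      (auto intro: holomorphic_on_imp_differentiable_at[of h V] holomorphic_on_imp_differentiable_at[of g "ball a r"])
  moreover have "deriv (h \<circ> g) a = deriv (\<lambda>u. u) a"
    using g(4) r by (intro deriv_cong_ev eventually_nhds_in_open[THEN eventually_mono, of "ball a r"]) auto
  ultimately have "1 \<le> cmod (deriv h 0) * (1 / r)"
    by (metis deriv_ident mult_left_mono norm_ge_zero norm_mult norm_one)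
  then show ?thesis using r by (simp add: field_simps)
qed

lemma Moebius_function_inverse_image:
  assumes "cmod w < 1" "cmod z < 1"
  shows "Moebius_function 0 w (Moebius_function 0 (-w) z) = z"
    "Moebius_function 0 (-w) (Moebius_function 0 w z) = z"
  using assms Moebius_function_compose[of w "-w" z] Moebius_function_compose[of "-w" w z] by auto

lemma deriv_Moebius_function:
  assumes "1 - cnj w * z \<noteq> 0"
  shows "(Moebius_function 0 w has_field_derivative (1 - cnj w * w) / (1 - cnj w * z)\<^sup>2) (at z)"
proof -
  have "((\<lambda>z. (z - w) / (1 - cnj w * z)) has_field_derivative
      (1 * (1 - cnj w * z) - (z - w) * (- cnj w)) / ((1 - cnj w * z) * (1 - cnj w * z))) (at z)"
    by (intro DERIV_divide assms) (auto intro!: derivative_eq_intros)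
  moreover have "1 * (1 - cnj w * z) - (z - w) * (- cnj w) = 1 - cnj w * w"
    by (simp add: algebra_simps)
  ultimately show ?thesis
    unfolding Moebius_function_simple[abs_def] power2_eq_square by (simp only:)
qed

text \<open>
  Koebe's osculation step: \<open>h\<close> is composed with the two-sheeted self-map \<open>s\<close> of the disc that
  fixes \<open>0\<close> and is branched over the omitted value \<open>b\<close>; sections over discs lift because
  discs are simply connected.
\<close>

lemma pointed_cover_sqrt_step:
  assumes pc: "pointed_cover D a V h" and b: "b \<in> ball 0 1 - V"
  shows "\<exists>V' h'. pointed_cover D a V' h' \<and>
           cmod (deriv h' 0) = cmod (deriv h 0) * (2 * sqrt (cmod b) / (1 + cmod b))"
proof -
  have V: "open V" "V \<subseteq> ball 0 1" "0 \<in> V" "h holomorphic_on V" "h ` V \<subseteq> D" "h 0 = a"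
    "disc_sections V h D"
    using pc by (auto simp: pointed_cover_def)
  define c where "c = csqrt (- b)"
  have c2: "c\<^sup>2 = - b" by (simp add: c_def)
  have nc: "cmod c = sqrt (cmod b)"
    using c2 by (metis norm_ge_zero norm_minus_cancel norm_power real_sqrt_unique)
  have lt: "cmod b < 1" "cmod c < 1" using b nc by auto
  have mb: "cmod (Moebius_function 0 w z) < 1" if "cmod w < 1" "cmod z < 1" for w z
    using Moebius_function_norm_lt_1 that by auto
  define \<phi> where "\<phi> = (\<lambda>w. Moebius_function 0 w)"
  have \<phi>1: "cmod (\<phi> w z) < 1" if "cmod w < 1" "cmod z < 1" for w z
    using mb that by (simp add: \<phi>_def)
  have \<phi>h: "\<phi> w holomorphic_on ball 0 1" if "cmod w < 1" for w
    using Moebius_function_holomorphic that by (simp add: \<phi>_def)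
  have \<phi>i: "\<phi> w (\<phi> (-w) z) = z" "\<phi> (-w) (\<phi> w z) = z" if "cmod w < 1" "cmod z < 1" for w z
    using Moebius_function_inverse_image that by (auto simp: \<phi>_def)
  define s where "s = (\<lambda>z. \<phi> (-b) ((\<phi> (-c) z)\<^sup>2))"
  have sq1: "cmod (z\<^sup>2) < 1" if "cmod z < 1" for z
    using that by (simp add: norm_power power_less_one_iff)
  have s1: "cmod (s z) < 1" if "cmod z < 1" for z
    using that lt \<phi>1 sq1 by (simp add: s_def)
  have shol: "s holomorphic_on ball 0 1"
    unfolding s_def using lt \<phi>1 sq1
    by (intro holomorphic_on_compose_gen[OF _ \<phi>h, unfolded o_def] holomorphic_intros \<phi>h) auto
  have s0: "s 0 = 0" by (simp add: s_def \<phi>_def Moebius_function_simple c2)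
  define V' where "V' = {z \<in> ball 0 1. s z \<in> V}"
  have oV': "open V'"
    using continuous_open_preimage[OF holomorphic_on_imp_continuous_on[OF shol] _ V(1)]
    by (simp add: V'_def vimage_def Int_def)
  have hol: "h \<circ> s holomorphic_on V'"
    by (rule holomorphic_on_compose_gen[OF holomorphic_on_subset[OF shol] V(4)]) (auto simp: V'_def)
  have "disc_sections V' (h \<circ> s) D"
    unfolding disc_sections_def
  proof (intro ballI allI impI)
    fix z1 w r assume z1: "z1 \<in> V'" and B: "ball w r \<subseteq> D" "(h \<circ> s) z1 \<in> ball w r"
    let ?u = "h (s z1)"
    have z1': "cmod z1 < 1" "s z1 \<in> V" using z1 by (auto simp: V'_def)
    obtain g where g: "g holomorphic_on ball w r" "\<And>u. u \<in> ball w r \<Longrightarrow> g u \<in> V" "g ?u = s z1"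
       "\<And>u. u \<in> ball w r \<Longrightarrow> h (g u) = u"
      using disc_sectionsE[OF V(7) z1'(2) B(1)] B(2) by auto
    have g1: "cmod (g u) < 1" "g u \<noteq> b" if "u \<in> ball w r" for u
      using g(2)[OF that] V(2) b by auto
    have nz: "\<phi> b (g u) \<noteq> 0" if "u \<in> ball w r" for u
    proof
      assume "\<phi> b (g u) = 0"
      then have "\<phi> (-b) 0 = g u" using \<phi>i(2)[OF lt(1) g1(1)[OF that]] by simp
      then show False using g1(2)[OF that] by (simp add: \<phi>_def Moebius_function_simple)
    qed
    have "(\<lambda>u. \<phi> b (g u)) holomorphic_on ball w r"
      using g1 by (intro holomorphic_on_compose_gen[OF g(1) \<phi>h[OF lt(1)], unfolded o_def]) auto
    then obtain q0 where q0: "q0 holomorphic_on ball w r" "\<And>u. u \<in> ball w r \<Longrightarrow> \<phi> b (g u) = (q0 u)\<^sup>2"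
      using nz simply_connected_eq_holomorphic_sqrt[of "ball w r"] convex_imp_simply_connected
        convex_ball open_ball by metis
    have "(q0 ?u)\<^sup>2 = (\<phi> (-c) z1)\<^sup>2"
      using q0(2)[of ?u] B(2) g(3) \<phi>i(1)[OF lt(1), of "(\<phi> (-c) z1)\<^sup>2"] sq1 \<phi>1 lt z1'
      by (simp add: s_def)
    then have "q0 ?u = \<phi> (-c) z1 \<or> q0 ?u = - \<phi> (-c) z1" by (simp add: power2_eq_iff)
    then obtain \<sigma> where \<sigma>: "\<sigma> * q0 ?u = \<phi> (-c) z1" "\<sigma>\<^sup>2 = (1::complex)"
      using that[of 1] that[of "-1"] by auto
    define q where "q = (\<lambda>u. \<sigma> * q0 u)"
    have q: "q holomorphic_on ball w r" "q ?u = \<phi> (-c) z1"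
      using \<sigma> q0 by (auto simp: q_def intro!: holomorphic_intros)
    have q2: "(q u)\<^sup>2 = \<phi> b (g u)" if "u \<in> ball w r" for u
      using that q0(2) \<sigma>(2) by (simp add: q_def power_mult_distrib)
    have q1: "cmod (q u) < 1" if "u \<in> ball w r" for u
    proof -
      have "cmod ((q u)\<^sup>2) < 1" using q2[OF that] \<phi>1 lt g1[OF that] by simp
      then show ?thesis by (simp add: norm_power power_less_one_iff)
    qed
    have sq: "s (\<phi> c (q u)) = g u" if "u \<in> ball w r" for u
      unfolding s_def \<phi>i(2)[OF lt(2) q1[OF that]] q2[OF that] by (rule \<phi>i(2)[OF lt(1) g1(1)[OF that]])
    show "\<exists>g. g holomorphic_on ball w r \<and> g ` ball w r \<subseteq> V' \<and> g ((h \<circ> s) z1) = z1 \<and>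
              (\<forall>u\<in>ball w r. (h \<circ> s) (g u) = u)"
    proof (intro exI conjI ballI)
      show "(\<lambda>u. \<phi> c (q u)) holomorphic_on ball w r"
        using q1 by (intro holomorphic_on_compose_gen[OF q(1) \<phi>h[OF lt(2)], unfolded o_def]) auto
      show "(\<lambda>u. \<phi> c (q u)) ` ball w r \<subseteq> V'"
        using sq g(2) \<phi>1 lt q1 by (auto simp: V'_def)
      show "\<phi> c (q ((h \<circ> s) z1)) = z1"
        using q(2) \<phi>i(1)[OF lt(2) z1'(1)] by simp
      show "(h \<circ> s) (\<phi> c (q u)) = u" if "u \<in> ball w r" for u
        using sq g(4) that by simp
    qed
  qed
  then have "pointed_cover D a V' (h \<circ> s)"
    unfolding pointed_cover_def using oV' hol V s0 by (auto simp: V'_def)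
  moreover have "cmod (deriv (h \<circ> s) 0) = cmod (deriv h 0) * (2 * sqrt (cmod b) / (1 + cmod b))"
  proof -
    have nb: "1 - cnj (-b) * c\<^sup>2 \<noteq> 0"
    proof
      assume "1 - cnj (-b) * c\<^sup>2 = 0"
      then have "cnj b * b = 1" using c2 by simp
      then have "cmod b ^ 2 = 1" by (metis complex_mod_cnj norm_mult norm_one power2_eq_square)
      then have "cmod b = 1 \<or> cmod b = -1" by (simp add: power2_eq_1_iff)
      then show False using lt norm_ge_zero[of b] by linarith
    qed
    have "(\<phi> (-c) has_field_derivative (1 - cnj c * c)) (at 0)"
      using deriv_Moebius_function[of "-c" 0] by (simp add: \<phi>_def)
    moreover have \<phi>c0: "\<phi> (-c) 0 = c" by (simp add: \<phi>_def Moebius_function_simple)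
    ultimately have 1: "((\<lambda>z. (\<phi> (-c) z)\<^sup>2) has_field_derivative 2 * c * (1 - cnj c * c)) (at 0)"
      using DERIV_power[of "\<phi> (-c)" "1 - cnj c * c" 0 UNIV 2] by (simp add: mult_ac)
    have "(\<phi> (-b) has_field_derivative (1 - cnj b * b) / (1 + cnj b * c\<^sup>2)\<^sup>2) (at (c\<^sup>2))"
      using deriv_Moebius_function[OF nb] by (simp add: \<phi>_def)
    then have "(\<phi> (-b) has_field_derivative (1 - cnj b * b) / (1 - cnj b * b)\<^sup>2) (at ((\<phi> (-c) 0)\<^sup>2))"
      using c2 \<phi>c0 by simp
    from DERIV_chain2[OF this 1] have ds: "deriv s 0 = (1 - cnj b * b) / (1 - cnj b * b)\<^sup>2 * (2 * c * (1 - cnj c * c))"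
      unfolding s_def by (rule DERIV_imp_deriv)
    have nn: "1 - cnj z * z = of_real (1 - (cmod z)\<^sup>2)" for z
      by (metis complex_norm_square mult.commute of_real_1 of_real_diff)
    have "cmod (deriv s 0) = 2 * sqrt (cmod b) * (1 - cmod b) / (1 - (cmod b)\<^sup>2)"
    proof -
      have "(cmod c)\<^sup>2 = cmod b" by (simp add: nc)
      moreover have "0 < 1 - cmod b" "0 < 1 - (cmod b)\<^sup>2"
        using lt by (simp_all add: power_less_one_iff)
      ultimately show ?thesis
        unfolding ds nn norm_mult norm_divide norm_power norm_of_real nc
        by (simp only: abs_of_pos) (simp add: power2_eq_square)
    qed
    also have "\<dots> = 2 * sqrt (cmod b) / (1 + cmod b)"
    proof -
      have "1 - (cmod b)\<^sup>2 = (1 - cmod b) * (1 + cmod b)" by algebra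
      then show ?thesis using lt by simp
    qed
    finally have "cmod (deriv s 0) = 2 * sqrt (cmod b) / (1 + cmod b)" .
    moreover have "deriv (h \<circ> s) 0 = deriv h 0 * deriv s 0"
      using V shol s0 by (subst deriv_chain)
        (auto intro: holomorphic_on_imp_differentiable_at[of h V] holomorphic_on_imp_differentiable_at[of s "ball 0 1"])
    ultimately show ?thesis by (simp add: norm_mult)
  qed
  ultimately show ?thesis by blast
qed

lemma pointed_cover_over_large_disc:
  assumes D: "open D" "bounded D" and a: "a \<in> D" and \<rho>: "\<rho> < 1"
  shows "\<exists>V h. pointed_cover D a V h \<and> ball 0 \<rho> \<subseteq> V"
proof (cases "\<rho> \<le> 0")
  case True
  then show ?thesis using pointed_cover_exists[OF D a] by (metis ball_empty empty_subsetI)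
next
  case False
  then have \<rho>0: "\<rho> > 0" by simp
  define X where "X = {cmod (deriv h 0) | V h. pointed_cover D a V h}"
  define m where "m = Inf X"
  obtain r where r: "r > 0" "ball a r \<subseteq> D" using D(1) a open_contains_ball by blast
  have X: "X \<noteq> {}" "\<And>x. x \<in> X \<Longrightarrow> r \<le> x"
    using pointed_cover_exists[OF D a] pointed_cover_deriv_ge[OF _ r] by (auto simp: X_def)
  then have "bdd_below X" by (meson bdd_below.I)
  have "m > 0" using cInf_greatest[OF X] r by (simp add: m_def)
  define \<kappa> where "\<kappa> = 2 * sqrt \<rho> / (1 + \<rho>)"
  have sqd: "(1 - sqrt t)\<^sup>2 = 1 + t - 2 * sqrt t" if "t \<ge> 0" for t
    using that by (simp add: power2_diff)
  have "0 < (1 - sqrt \<rho>)\<^sup>2" using \<rho> \<rho>0 by (simp add: real_sqrt_eq_1_iff)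
  then have \<kappa>: "0 < \<kappa>" "\<kappa> < 1" using \<rho>0 sqd[of \<rho>] by (auto simp: \<kappa>_def divide_simps)
  then have "m < m / \<kappa>" using \<open>m > 0\<close> by (simp add: field_simps)
  then obtain x where "x \<in> X" "x < m / \<kappa>" using cInf_lessD[OF X(1)] unfolding m_def by metis
  then obtain V h where pc: "pointed_cover D a V h" and lt: "cmod (deriv h 0) * \<kappa> < m"
    using \<kappa> by (auto simp: X_def field_simps)
  have "ball 0 \<rho> \<subseteq> V"
  proof (rule subsetI, rule ccontr)
    fix b assume b: "b \<in> ball 0 \<rho>" "b \<notin> V"
    then obtain V' h' where pc': "pointed_cover D a V' h'"
        and d: "cmod (deriv h' 0) = cmod (deriv h 0) * (2 * sqrt (cmod b) / (1 + cmod b))"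
      using pointed_cover_sqrt_step[OF pc, of b] \<rho> by auto
    have "2 * sqrt (cmod b) / (1 + cmod b) \<le> \<kappa>"
    proof -
      define x y where "x = sqrt (cmod b)" and "y = sqrt \<rho>"
      have xy: "0 \<le> x" "x \<le> y" "y < 1" "cmod b = x\<^sup>2" "\<rho> = y\<^sup>2" using b \<rho> \<rho>0 by (auto simp: x_def y_def)
      have "x * y \<le> 1" using xy mult_le_one[of x y] by linarith
      then have "0 \<le> (y - x) * (1 - x * y)" using xy by simp
      then have "x * (1 + y\<^sup>2) \<le> y * (1 + x\<^sup>2)" by (simp add: algebra_simps power2_eq_square)
      moreover have "1 + x\<^sup>2 > 0" "1 + y\<^sup>2 > 0" by (simp_all add: add_pos_nonneg)
      ultimately have "2 * x / (1 + x\<^sup>2) \<le> 2 * y / (1 + y\<^sup>2)" by (simp add: divide_simps)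
      then show ?thesis unfolding \<kappa>_def xy(4,5)[symmetric] by (simp only: x_def y_def)
    qed
    then have "cmod (deriv h' 0) < m" using d lt by (metis mult_left_mono norm_ge_zero order_le_less_trans)
    moreover have "cmod (deriv h' 0) \<in> X" using pc' by (auto simp: X_def)
    ultimately show False using cInf_lower[OF _ \<open>bdd_below X\<close>] by (fastforce simp: m_def)
  qed
  with pc show ?thesis by blast
qed

lemma uniform_limit_moving_point:
  fixes F :: "nat \<Rightarrow> 'a::topological_space \<Rightarrow> 'b::real_normed_vector"
  assumes u: "uniform_limit K F g sequentially" and c: "continuous_on K g"
    and x: "\<forall>\<^sub>F n in sequentially. x n \<in> K" "x \<longlonglongrightarrow> l" "l \<in> K"
  shows "(\<lambda>n. F n (x n)) \<longlonglongrightarrow> g l"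
proof -
  have "(\<lambda>n. F n (x n) - g (x n)) \<longlonglongrightarrow> 0"
  proof (rule tendstoI)
    fix e :: real assume "e > 0"
    from uniform_limitD[OF u this] x(1)
    show "\<forall>\<^sub>F n in sequentially. dist (F n (x n) - g (x n)) 0 < e"
      by eventually_elim (auto simp: dist_norm)
  qed
  moreover have "(\<lambda>n. g (x n)) \<longlonglongrightarrow> g l"
    by (rule continuous_on_tendsto_compose[OF c x(2,3,1)])
  ultimately show ?thesis using tendsto_add by fastforce
qed

theorem holomorphic_universal_covering_exists:
  assumes D: "open D" "connected D" "bounded D" and a: "a \<in> D"
  shows "\<exists>\<pi>. holomorphic_universal_covering D \<pi> \<and> \<pi> 0 = a"
proof -
  define r0 :: "nat \<Rightarrow> real" where "r0 = (\<lambda>n. 1 - inverse (real (Suc (Suc n))))"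
  have r0: "0 < r0 n" "r0 n < 1" for n by (auto simp: r0_def inverse_eq_divide)
  have r0_lim: "r0 \<longlonglongrightarrow> 1"
    unfolding r0_def using tendsto_diff[OF tendsto_const[of 1] LIMSEQ_Suc[OF LIMSEQ_inverse_real_of_nat]]
    by simp
  have "\<exists>V h. pointed_cover D a V h \<and> ball 0 (r0 n) \<subseteq> V" for n
    using pointed_cover_over_large_disc[OF D(1,3) a r0(2)] .
  then obtain V0 h0 where pc0: "\<And>n. pointed_cover D a (V0 n) (h0 n)" "\<And>n. ball 0 (r0 n) \<subseteq> V0 n"
    by metis
  define k0 where "k0 = (\<lambda>n z. h0 n (of_real (r0 n) * z))"
  have in0: "of_real (r0 n) * z \<in> V0 n" if "z \<in> ball 0 1" for n z
  proof -
    have "r0 n * cmod z < r0 n * 1" using that r0(1)[of n] by (intro mult_strict_left_mono) auto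
    then have "of_real (r0 n) * z \<in> ball 0 (r0 n)" using r0(1)[of n] by (simp add: norm_mult)
    then show ?thesis using pc0(2) by blast
  qed
  have hol0: "k0 n holomorphic_on ball 0 1" for n
  proof -
    have "h0 n holomorphic_on V0 n" using pc0 by (auto simp: pointed_cover_def)
    then show ?thesis
      unfolding k0_def using in0
      by (intro holomorphic_on_compose_gen[of "\<lambda>z. of_real (r0 n) * z" _ "h0 n" "V0 n", unfolded o_def])
        (auto intro!: holomorphic_intros)
  qed
  have im0: "k0 n z \<in> D" if "z \<in> ball 0 1" for n z
    using in0[OF that] pc0(1)[of n] unfolding k0_def pointed_cover_def by blast
  obtain B where B: "\<And>x. x \<in> D \<Longrightarrow> cmod x \<le> B" using D(3) bounded_iff by metis
  obtain f \<sigma> where f: "f holomorphic_on ball 0 1" and \<sigma>: "strict_mono (\<sigma> :: nat \<Rightarrow> nat)"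
    and pt: "\<And>z. z \<in> ball 0 1 \<Longrightarrow> (\<lambda>n. k0 (\<sigma> n) z) \<longlonglongrightarrow> f z"
    and ul: "\<And>K. compact K \<Longrightarrow> K \<subseteq> ball 0 1 \<Longrightarrow> uniform_limit K (k0 \<circ> \<sigma>) f sequentially"
  proof (rule Montel[of "ball 0 1" "range k0" k0])
    show "\<exists>B. \<forall>h\<in>range k0. \<forall>z\<in>K. cmod (h z) \<le> B" if "compact K" "K \<subseteq> ball 0 1" for K
      using that im0 B by blast
  qed (use hol0 in auto)
  define k V h r where "k = k0 \<circ> \<sigma>" and "V = V0 \<circ> \<sigma>" and "h = h0 \<circ> \<sigma>" and "r = r0 \<circ> \<sigma>"
  have pc: "pointed_cover D a (V n) (h n)" for n using pc0 by (simp add: V_def h_def)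
  have r: "0 < r n" "r n < 1" for n using r0 by (auto simp: r_def)
  have r_lim: "r \<longlonglongrightarrow> 1"
    unfolding r_def by (rule LIMSEQ_subseq_LIMSEQ[OF r0_lim \<sigma>])
  have inV: "of_real (r n) * z \<in> V n" if "z \<in> ball 0 1" for n z
    using in0[OF that] by (simp add: r_def V_def)
  have k: "k n z = h n (of_real (r n) * z)" for n z by (simp add: k_def k0_def h_def r_def)
  have kD: "k n z \<in> D" if "z \<in> ball 0 1" for n z using im0[OF that] by (simp add: k_def)
  have pt: "(\<lambda>n. k n z) \<longlonglongrightarrow> f z" if "z \<in> ball 0 1" for z using pt[OF that] by (simp add: k_def)
  have ul: "uniform_limit K k f sequentially" if "compact K" "K \<subseteq> ball 0 1" for K
    using ul[OF that] by (simp add: k_def)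
  have "k n 0 = a" for n using pc by (simp add: k pointed_cover_def)
  then have f0: "f 0 = a" using pt[of 0] by (simp add: LIMSEQ_const_iff)
  have contf: "continuous_on K f" if "K \<subseteq> ball 0 1" for K
    using f that by (meson continuous_on_subset holomorphic_on_imp_continuous_on)
  have sec: "disc_sections (ball 0 1) f D"
    unfolding disc_sections_def
  proof (intro ballI allI impI)
    fix z w s assume z: "z \<in> ball (0::complex) 1" and T: "ball w s \<subseteq> D" "f z \<in> ball w s"
    define T where "T = ball w s"
    obtain N where N: "\<And>n. n \<ge> N \<Longrightarrow> k n z \<in> T"
      using topological_tendstoD[OF pt[OF z], of T] T(2) by (auto simp: T_def eventually_sequentially)
    have "\<exists>g. g holomorphic_on T \<and> (\<forall>u\<in>T. g u \<in> V n) \<and> g (k n z) = of_real (r n) * z \<and>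
            (\<forall>u\<in>T. h n (g u) = u)" if "n \<ge> N" for n
      using disc_sectionsE[of "V n" "h n" D "of_real (r n) * z" w s] pc[of n] inV[OF z] T(1) N[OF that]
      unfolding T_def k pointed_cover_def by metis
    then obtain g0 where g0: "\<And>n. n \<ge> N \<Longrightarrow> g0 n holomorphic_on T" "\<And>n u. n \<ge> N \<Longrightarrow> u \<in> T \<Longrightarrow> g0 n u \<in> V n"
        "\<And>n. n \<ge> N \<Longrightarrow> g0 n (k n z) = of_real (r n) * z" "\<And>n u. n \<ge> N \<Longrightarrow> u \<in> T \<Longrightarrow> h n (g0 n u) = u"
      by metis
    have V1: "V n \<subseteq> ball 0 1" for n using pc by (simp add: pointed_cover_def)
    have g0le: "cmod (g0 n u) \<le> 1" if "n \<ge> N" "u \<in> T" for n u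
      using g0(2)[OF that] V1[of n] by auto
    obtain g \<tau> where g: "g holomorphic_on T" and \<tau>: "strict_mono (\<tau> :: nat \<Rightarrow> nat)"
      and gpt: "\<And>u. u \<in> T \<Longrightarrow> (\<lambda>n. g0 (\<tau> n + N) u) \<longlonglongrightarrow> g u"
      and gul: "\<And>K. compact K \<Longrightarrow> K \<subseteq> T \<Longrightarrow> uniform_limit K ((\<lambda>n. g0 (n + N)) \<circ> \<tau>) g sequentially"
    proof (rule Montel[of T "range (\<lambda>n. g0 (n + N))" "\<lambda>n. g0 (n + N)"])
      show "\<exists>B. \<forall>h\<in>range (\<lambda>n. g0 (n + N)). \<forall>z\<in>K. cmod (h z) \<le> B" if "compact K" "K \<subseteq> T" for K
        using that g0le by (intro exI[of _ 1]) auto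
    qed (use g0(1) in \<open>auto simp: T_def\<close>)
    define m where "m = (\<lambda>n. \<tau> n + N)"
    have m: "strict_mono m" "m n \<ge> N" for n using \<tau> by (auto simp: m_def strict_mono_def)
    have gm: "(\<lambda>n. g0 (m n) u) \<longlonglongrightarrow> g u" if "u \<in> T" for u using gpt[OF that] by (simp add: m_def)
    have rm: "(\<lambda>n. r (m n)) \<longlonglongrightarrow> 1" using LIMSEQ_subseq_LIMSEQ[OF r_lim m(1)] by (simp add: o_def)
    have fzT: "f z \<in> T" using T by (simp add: T_def)
    have gz: "g (f z) = z"
    proof (rule LIMSEQ_unique)
      obtain e where e: "e > 0" "cball (f z) e \<subseteq> T"
        using fzT open_contains_cball[of T] open_ball T_def by blast
      have l: "(\<lambda>n. k (m n) z) \<longlonglongrightarrow> f z" using LIMSEQ_subseq_LIMSEQ[OF pt[OF z] m(1)] by (simp add: o_def)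
      show "(\<lambda>n. g0 (m n) (k (m n) z)) \<longlonglongrightarrow> g (f z)"
      proof (rule uniform_limit_moving_point[OF _ _ _ l])
        show "uniform_limit (cball (f z) e) (\<lambda>n. g0 (m n)) g sequentially"
          using gul[OF _ e(2)] by (simp add: m_def o_def)
        show "continuous_on (cball (f z) e) g"
          using g e(2) by (meson continuous_on_subset holomorphic_on_imp_continuous_on)
        show "\<forall>\<^sub>F n in sequentially. k (m n) z \<in> cball (f z) e"
          using tendstoD[OF l e(1)] by eventually_elim (simp add: dist_commute)
      qed (use e in auto)
      have "(\<lambda>n. of_real (r (m n)) * z) \<longlonglongrightarrow> of_real 1 * z"
        by (intro tendsto_intros rm)
      then show "(\<lambda>n. g0 (m n) (k (m n) z)) \<longlonglongrightarrow> z" using g0(3) m(2) by simp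
    qed
    have gle: "cmod (g u) \<le> 1" if "u \<in> T" for u
      using gm[OF that] g0le m(2) that by (intro LIMSEQ_le_const2[OF tendsto_norm[OF gm[OF that]]]) auto
    have g1: "g u \<in> ball 0 1" if u: "u \<in> T" for u
    proof (rule ccontr)
      assume "\<not> ?thesis"
      then have "cmod (g u) = 1" using gle[OF u] by simp
      then have "g constant_on T"
        using u gle by (intro maximum_modulus_principle[OF g _ _ _ order_refl u]) (auto simp: T_def)
      then have "g u = z" using u fzT gz by (auto simp: constant_on_def)
      then show False using z \<open>cmod (g u) = 1\<close> by simp
    qed
    have fg: "f (g u) = u" if u: "u \<in> T" for u
    proof (rule LIMSEQ_unique)
      define x where "x = (\<lambda>n. g0 (m n) u / of_real (r (m n)))"
      have x: "x \<longlonglongrightarrow> g u"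
        unfolding x_def using tendsto_divide[OF gm[OF u] tendsto_of_real[OF rm]] by simp
      obtain e where e: "e > 0" "cball (g u) e \<subseteq> ball 0 1"
        using g1[OF u] open_contains_cball[of "ball (0::complex) 1"] open_ball by blast
      have ev: "\<forall>\<^sub>F n in sequentially. x n \<in> cball (g u) e"
        using tendstoD[OF x e(1)] by eventually_elim (simp add: dist_commute)
      have ulm: "uniform_limit (cball (g u) e) (\<lambda>n. k (m n)) f sequentially"
        using filterlim_compose[OF ul[OF compact_cball e(2)] filterlim_subseq[OF m(1)]] .
      show "(\<lambda>n. k (m n) (x n)) \<longlonglongrightarrow> f (g u)"
        by (rule uniform_limit_moving_point[OF ulm contf[OF e(2)] ev x]) (use e in auto)
      have "k (m n) (x n) = u" for n
        using g0(4)[OF m(2) u] r(1)[of "m n"] by (simp add: k x_def)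
      then show "(\<lambda>n. k (m n) (x n)) \<longlonglongrightarrow> u" by simp
    qed
    show "\<exists>g. g holomorphic_on ball w s \<and> g ` ball w s \<subseteq> ball 0 1 \<and> g (f z) = z \<and>
              (\<forall>u\<in>ball w s. f (g u) = u)"
      using g g1 gz fg by (intro exI[of _ g]) (auto simp: T_def)
  qed
  have nc: "\<not> f constant_on ball 0 1"
  proof
    assume "f constant_on ball 0 1"
    then have const: "f z = a" if "z \<in> ball 0 1" for z using that f0 by (auto simp: constant_on_def)
    obtain e where e: "e > 0" "ball a e \<subseteq> D" using D(1) a open_contains_ball by blast
    have "f 0 \<in> ball a e" "0 \<in> ball (0::complex) 1" using e f0 by auto
    then obtain g where "\<And>u. u \<in> ball a e \<Longrightarrow> g u \<in> ball 0 1" "\<And>u. u \<in> ball a e \<Longrightarrow> f (g u) = u"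
      using disc_sectionsE[OF sec _ e(2)] by metis
    moreover have "a + of_real (e/2) \<in> ball a e" using e by (simp add: dist_norm)
    ultimately have "a + of_real (e/2) = a" using const by metis
    then show False using e by simp
  qed
  have "f z \<in> D" if z: "z \<in> ball 0 1" for z
  proof (rule ccontr)
    assume nD: "f z \<notin> D"
    have "f z - f z \<noteq> 0"
    proof (rule Hurwitz_no_zeros[of "ball 0 1" "\<lambda>n u. k n u - f z" "\<lambda>u. f u - f z" z])
      show "(\<lambda>u. k n u - f z) holomorphic_on ball 0 1" for n
        using hol0 by (auto simp: k_def intro!: holomorphic_intros)
      show "uniform_limit K (\<lambda>n u. k n u - f z) (\<lambda>u. f u - f z) sequentially"
        if "compact K" "K \<subseteq> ball 0 1" for K
        by (intro uniform_limit_minus ul[OF that] uniform_limit_const)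
      show "\<not> (\<lambda>u. f u - f z) constant_on ball 0 1"
        using nc by (auto simp: constant_on_def) (metis diff_add_cancel)
      show "k n u - f z \<noteq> 0" if "u \<in> ball 0 1" for n u using kD[OF that, of n] nD by auto
    qed (use z f in \<open>auto intro!: holomorphic_intros\<close>)
    then show False by simp
  qed
  then have "covering_space (ball 0 1) f D"
    by (intro covering_space_if_disc_sections f D sec) auto
  with f f0 show ?thesis unfolding holomorphic_universal_covering_def by blast
qed

subsection \<open>The hyperbolic density and the rigidity constants\<close>

lemma deriv_le_deriv_universal_covering:
  assumes cov: "holomorphic_universal_covering D \<pi>"
    and f: "f holomorphic_on ball 0 1" "f ` ball 0 1 \<subseteq> D" "f 0 = \<pi> 0"
  shows "cmod (deriv f 0) \<le> cmod (deriv \<pi> 0)"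
proof -
  have \<pi>: "\<pi> holomorphic_on ball 0 1" "covering_space (ball 0 1) \<pi> D"
    using cov by (auto simp: holomorphic_universal_covering_def)
  obtain g where g: "continuous_on (ball 0 1) g" "g \<in> ball 0 1 \<rightarrow> ball 0 1" "g 0 = 0"
      "\<And>y. y \<in> ball 0 1 \<Longrightarrow> \<pi> (g y) = f y"
  proof (rule covering_space_lift_strong[OF \<pi>(2), of 0 0 "ball 0 1" f])
    show "simply_connected (ball (0::complex) 1)" by (simp add: convex_imp_simply_connected)
    show "locally path_connected (ball (0::complex) 1)" by (simp add: convex_imp_locally_path_connected)
    show "f \<in> ball 0 1 \<rightarrow> D" using f by auto
  qed (use f in \<open>auto intro: holomorphic_on_imp_continuous_on\<close>)
  have "f \<in> ball 0 1 \<rightarrow> D" using f by auto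
  then have hol: "g holomorphic_on ball 0 1"
    using covering_space_lift_is_holomorphic[OF \<pi>(2) open_ball \<pi>(1) f(1) _ g(2,1,4)] by blast
  have "deriv f 0 = deriv (\<pi> \<circ> g) 0"
    using g(4) by (intro deriv_cong_ev eventually_nhds_in_open[THEN eventually_mono, of "ball 0 1"]) auto
  also have "\<dots> = deriv \<pi> 0 * deriv g 0"
    using \<pi>(1) hol g(3) by (subst deriv_chain)
      (auto intro: holomorphic_on_imp_differentiable_at[of _ "ball 0 1"])
  finally have "cmod (deriv f 0) = cmod (deriv \<pi> 0) * cmod (deriv g 0)" by (simp add: norm_mult)
  moreover have "cmod (deriv g 0) \<le> 1"
    using Schwarz_Lemma(2)[of g 0] hol g(2,3) by (auto simp: Pi_iff)
  ultimately show ?thesis by (simp add: mult_left_le)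
qed

lemma hyperbolic_density_eq:
  assumes cov: "holomorphic_universal_covering D \<pi>"
  shows "hyperbolic_density D (\<pi> 0) = 1 / cmod (deriv \<pi> 0)"
  unfolding hyperbolic_density_def
proof (rule the_equality)
  show "\<exists>\<pi>'. holomorphic_universal_covering D \<pi>' \<and> \<pi>' 0 = \<pi> 0 \<and> 1 / cmod (deriv \<pi> 0) = 1 / cmod (deriv \<pi>' 0)"
    using cov by blast
next
  fix l assume "\<exists>\<pi>'. holomorphic_universal_covering D \<pi>' \<and> \<pi>' 0 = \<pi> 0 \<and> l = 1 / cmod (deriv \<pi>' 0)"
  then obtain \<pi>' where \<pi>': "holomorphic_universal_covering D \<pi>'" "\<pi>' 0 = \<pi> 0" "l = 1 / cmod (deriv \<pi>' 0)"
    by blast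
  have map: "\<pi> holomorphic_on ball 0 1" "\<pi> ` ball 0 1 \<subseteq> D"
    if "holomorphic_universal_covering D \<pi>" for \<pi>
    using that covering_space_imp_surjective by (auto simp: holomorphic_universal_covering_def)
  have "cmod (deriv \<pi>' 0) = cmod (deriv \<pi> 0)"
    using deriv_le_deriv_universal_covering[OF cov map[OF \<pi>'(1)] \<pi>'(2)]
      deriv_le_deriv_universal_covering[OF \<pi>'(1) map[OF cov] \<pi>'(2)[symmetric]] by simp
  then show "l = 1 / cmod (deriv \<pi> 0)" using \<pi>'(3) by simp
qed

lemma hyperbolic_density_covering:
  assumes D: "open D" "connected D" "bounded D" and a: "a \<in> D"
  obtains \<pi> where "\<pi> holomorphic_on ball 0 1" "\<pi> ` ball 0 1 = D" "\<pi> 0 = a" "deriv \<pi> 0 \<noteq> 0"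
    "hyperbolic_density D a = 1 / cmod (deriv \<pi> 0)"
    "\<And>f. f holomorphic_on ball 0 1 \<Longrightarrow> f ` ball 0 1 \<subseteq> D \<Longrightarrow> f 0 = a \<Longrightarrow>
       cmod (deriv f 0) \<le> cmod (deriv \<pi> 0)"
proof -
  obtain \<pi> where \<pi>: "holomorphic_universal_covering D \<pi>" "\<pi> 0 = a"
    using holomorphic_universal_covering_exists[OF assms] by blast
  obtain e where e: "e > 0" "ball a e \<subseteq> D" using D(1) a open_contains_ball by blast
  define f where "f = (\<lambda>z. a + of_real e * z)"
  have "a + of_real e * z \<in> ball a e" if "z \<in> ball 0 1" for z
    using that e by (simp add: dist_norm norm_mult)
  then have "f ` ball 0 1 \<subseteq> D" using e(2) by (auto simp: f_def)
  moreover have "f holomorphic_on ball 0 1" unfolding f_def by (intro holomorphic_intros)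
  moreover have "f 0 = \<pi> 0" using \<pi> by (simp add: f_def)
  ultimately have "cmod (deriv f 0) \<le> cmod (deriv \<pi> 0)"
    by (intro deriv_le_deriv_universal_covering[OF \<pi>(1)])
  moreover have "deriv f 0 = of_real e"
    unfolding f_def by (rule DERIV_imp_deriv) (auto intro!: derivative_eq_intros)
  ultimately have "deriv \<pi> 0 \<noteq> 0" using e by auto
  moreover have "\<pi> holomorphic_on ball 0 1" "\<pi> ` ball 0 1 = D"
    using \<pi>(1) covering_space_imp_surjective by (auto simp: holomorphic_universal_covering_def)
  ultimately show thesis
    using that[of \<pi>] \<pi> hyperbolic_density_eq[OF \<pi>(1)] deriv_le_deriv_universal_covering[OF \<pi>(1)] by simp
qed

lemma hyperbolic_density_pos:
  assumes "open D" "connected D" "bounded D" "a \<in> D"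
  shows "hyperbolic_density D a > 0"
  using hyperbolic_density_covering[OF assms] by (metis divide_pos_pos zero_less_norm_iff zero_less_one)

lemma hyperbolic_density_disc_map_le:
  assumes D: "open D" "connected D" "bounded D" "a \<in> D"
    and f: "f holomorphic_on ball 0 1" "f ` ball 0 1 \<subseteq> D" "f 0 = a"
  shows "hyperbolic_density D a * cmod (deriv f 0) \<le> 1"
proof -
  obtain \<pi> where \<pi>: "deriv \<pi> 0 \<noteq> 0" "hyperbolic_density D a = 1 / cmod (deriv \<pi> 0)"
    "cmod (deriv f 0) \<le> cmod (deriv \<pi> 0)"
    using hyperbolic_density_covering[OF D] f by metis
  then show ?thesis by (simp add: divide_le_eq_1)
qed

lemma hyperbolic_density_contraction:
  assumes D: "open D" "connected D" "bounded D" "a \<in> D"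
    and D': "open D'" "connected D'" "bounded D'"
    and f: "f holomorphic_on D" "f ` D \<subseteq> D'"
  shows "hyperbolic_density D' (f a) * cmod (deriv f a) / hyperbolic_density D a \<le> 1"
proof -
  obtain \<pi> where \<pi>: "\<pi> holomorphic_on ball 0 1" "\<pi> ` ball 0 1 = D" "\<pi> 0 = a" "deriv \<pi> 0 \<noteq> 0"
    "hyperbolic_density D a = 1 / cmod (deriv \<pi> 0)"
    using hyperbolic_density_covering[OF D] by metis
  have "f \<circ> \<pi> holomorphic_on ball 0 1"
    using \<pi>(2) by (intro holomorphic_on_compose_gen[OF \<pi>(1) f(1)]) auto
  moreover have "(f \<circ> \<pi>) ` ball 0 1 \<subseteq> D'" using \<pi>(2) f(2) by (metis image_comp)
  moreover have "f a \<in> D'" using D(4) f(2) by blast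
  ultimately have "hyperbolic_density D' (f a) * cmod (deriv (f \<circ> \<pi>) 0) \<le> 1"
    using \<pi>(3) by (intro hyperbolic_density_disc_map_le[OF D']) auto
  moreover have "deriv (f \<circ> \<pi>) 0 = deriv f a * deriv \<pi> 0"
    using \<pi>(1,3) f(1) D(1,4) by (subst deriv_chain)
      (auto intro: holomorphic_on_imp_differentiable_at[of \<pi> "ball 0 1"] holomorphic_on_imp_differentiable_at[of f D])
  ultimately show ?thesis using \<pi>(5) by (simp add: norm_mult mult.assoc)
qed

text \<open>
  The image of \<open>f\<close> lies in the compact set \<open>\<psi> ` cball 0 \<rho>\<close>, so \<open>f\<close> cannot be onto the open
  bounded set \<open>X\<close>; hence it is neither an automorphism nor a covering.
\<close>

lemma composite_through_smaller_disc:
  assumes D: "open D" "z \<in> D" and X: "open X" "bounded X"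
    and \<phi>: "\<phi> holomorphic_on D" "\<phi> ` D \<subseteq> ball 0 1" "\<phi> z = 0"
    and \<psi>: "\<psi> holomorphic_on ball 0 1" "\<psi> ` ball 0 1 \<subseteq> X"
    and \<rho>: "0 < \<rho>" "\<rho> < 1"
  obtains f where "f holomorphic_on D" "f ` D \<subseteq> X" "f ` D \<noteq> X" "f z = \<psi> 0"
    "cmod (deriv f z) = \<rho> * (cmod (deriv \<psi> 0) * cmod (deriv \<phi> z))"
proof -
  define g where "g = (\<lambda>u. of_real \<rho> * \<phi> u)"
  have g: "g holomorphic_on D" "g z = 0"
    using \<phi> by (auto simp: g_def intro!: holomorphic_intros)
  have g\<rho>: "g u \<in> cball 0 \<rho>" if "u \<in> D" for u
  proof -
    have "cmod (\<phi> u) < 1" using \<phi>(2) that by auto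
    then show ?thesis using \<rho> by (simp add: g_def norm_mult mult_left_le)
  qed
  have sub: "cball 0 \<rho> \<subseteq> ball (0::complex) 1" using \<rho> by auto
  define f where "f = \<psi> \<circ> g"
  have hol: "f holomorphic_on D"
    unfolding f_def using g\<rho> sub by (intro holomorphic_on_compose_gen[OF g(1) \<psi>(1)]) blast
  have im: "f ` D \<subseteq> \<psi> ` cball 0 \<rho>" "\<psi> ` cball 0 \<rho> \<subseteq> X"
    using g\<rho> \<psi>(2) sub by (auto simp: f_def)
  have "f ` D \<noteq> X"
  proof
    assume "f ` D = X"
    then have "X = \<psi> ` cball 0 \<rho>" using im by auto
    moreover have "compact (\<psi> ` cball 0 \<rho>)"
      using \<psi>(1) sub by (intro compact_continuous_image compact_cball)
        (meson continuous_on_subset holomorphic_on_imp_continuous_on)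
    ultimately have "closed X" by (simp add: compact_imp_closed)
    then have "X = {} \<or> X = UNIV" using X(1) clopen by blast
    moreover have "X \<noteq> {}" using \<open>f ` D = X\<close> D(2) by blast
    ultimately show False using X(2) not_bounded_UNIV by auto
  qed
  moreover have "deriv f z = deriv \<psi> 0 * deriv g z"
    unfolding f_def using g \<psi>(1) D by (subst deriv_chain)
      (auto intro: holomorphic_on_imp_differentiable_at[of g D] holomorphic_on_imp_differentiable_at[of \<psi> "ball 0 1"])
  moreover have "deriv g z = of_real \<rho> * deriv \<phi> z"
    unfolding g_def using \<phi>(1) D by (intro deriv_cmult holomorphic_on_imp_differentiable_at)
  ultimately show thesis
    using that[of f] hol im g(2) \<rho> by (auto simp: f_def norm_mult)
qed

lemma rigidity_const_bounds:
  assumes D: "open D" "connected D" "bounded D" "z \<in> D"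
    and \<phi>: "\<phi> holomorphic_on D" "\<phi> ` D \<subseteq> ball 0 1" "\<phi> z = 0"
    and \<psi>: "\<psi> holomorphic_on ball 0 1" "\<psi> ` ball 0 1 \<subseteq> D" "\<psi> 0 = z"
  shows "rigidity_const D z \<in> {cmod (deriv \<psi> 0) * cmod (deriv \<phi> z)..1}"
proof -
  define S where "S = {cmod (deriv f z) | f. f holomorphic_on D \<and> f ` D \<subseteq> D \<and> f z = z \<and>
     \<not> holomorphic_automorphism D f}"
  define c where "c = cmod (deriv \<psi> 0) * cmod (deriv \<phi> z)"
  have le: "x \<le> 1" if x: "x \<in> S" for x
  proof -
    obtain f where f: "x = cmod (deriv f z)" "f holomorphic_on D" "f ` D \<subseteq> D" "f z = z"
      using x unfolding S_def by blast
    then show ?thesis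
      using hyperbolic_density_contraction[OF D D(1-3) f(2,3)] hyperbolic_density_pos[OF D] by simp
  qed
  then have bdd: "bdd_above S" by (meson bdd_above.I)
  have mem: "\<rho> * c \<in> S" if \<rho>: "0 < \<rho>" "\<rho> < 1" for \<rho>
  proof -
    obtain f where f: "f holomorphic_on D" "f ` D \<subseteq> D" "f ` D \<noteq> D" "f z = \<psi> 0"
       "cmod (deriv f z) = \<rho> * (cmod (deriv \<psi> 0) * cmod (deriv \<phi> z))"
      using composite_through_smaller_disc[OF D(1,4) D(1,3) \<phi> \<psi>(1,2) \<rho>] .
    have "\<not> holomorphic_automorphism D f"
      using f(3) by (auto simp: holomorphic_automorphism_def homeomorphism_def)
    then show ?thesis unfolding S_def c_def using f \<psi>(3) by force
  qed
  have "c \<le> Sup S"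
    by (rule field_le_mult_one_interval) (rule cSup_upper[OF mem bdd])
  moreover have "Sup S \<le> 1" using mem[of "1/2"] le by (intro cSup_least) auto
  ultimately show ?thesis by (simp add: rigidity_const_def S_def c_def)
qed

lemma rigidity_const2_bounds:
  assumes D: "open D" "connected D" "bounded D" "z \<in> D"
    and D': "open D'" "connected D'" "bounded D'" "w \<in> D'"
    and \<phi>: "\<phi> holomorphic_on D" "\<phi> ` D \<subseteq> ball 0 1" "\<phi> z = 0"
    and \<psi>: "\<psi> holomorphic_on ball 0 1" "\<psi> ` ball 0 1 \<subseteq> D" "\<psi> 0 = z"
  shows "rigidity_const2 D D' z w \<in> {cmod (deriv \<psi> 0) * cmod (deriv \<phi> z)..1}"
proof -
  define S where "S = {hyperbolic_density D' w * cmod (deriv f z) / hyperbolic_density D z | f.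
     f \<in> noncovering_maps D D' \<and> f z = w}"
  define c where "c = cmod (deriv \<phi> z) / hyperbolic_density D z"
  have le: "x \<le> 1" if x: "x \<in> S" for x
  proof -
    obtain f where f: "x = hyperbolic_density D' w * cmod (deriv f z) / hyperbolic_density D z"
        "f holomorphic_on D" "f ` D \<subseteq> D'" "f z = w"
      using x unfolding S_def noncovering_maps_def by blast
    then show ?thesis using hyperbolic_density_contraction[OF D D'(1-3) f(2,3)] by simp
  qed
  then have bdd: "bdd_above S" by (meson bdd_above.I)
  obtain \<pi> where \<pi>: "\<pi> holomorphic_on ball 0 1" "\<pi> ` ball 0 1 = D'" "\<pi> 0 = w" "deriv \<pi> 0 \<noteq> 0"
    "hyperbolic_density D' w = 1 / cmod (deriv \<pi> 0)"
    using hyperbolic_density_covering[OF D'] by metis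
  have mem: "\<rho> * c \<in> S" if \<rho>: "0 < \<rho>" "\<rho> < 1" for \<rho>
  proof -
    obtain f where f: "f holomorphic_on D" "f ` D \<subseteq> D'" "f ` D \<noteq> D'" "f z = \<pi> 0"
       "cmod (deriv f z) = \<rho> * (cmod (deriv \<pi> 0) * cmod (deriv \<phi> z))"
      using composite_through_smaller_disc[OF D(1,4) D'(1,3) \<phi> \<pi>(1) equalityD1[OF \<pi>(2)] \<rho>] .
    have "f \<in> noncovering_maps D D'"
      using f(1-3) by (auto simp: noncovering_maps_def dest: covering_space_imp_surjective)
    moreover have "\<rho> * c = hyperbolic_density D' w * cmod (deriv f z) / hyperbolic_density D z"
      unfolding f(5) \<pi>(5) c_def using \<pi>(4) by simp
    ultimately show ?thesis unfolding S_def using f(4) \<pi>(3) by blast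
  qed
  have "c \<le> Sup S"
    by (rule field_le_mult_one_interval) (rule cSup_upper[OF mem bdd])
  moreover have "cmod (deriv \<psi> 0) * cmod (deriv \<phi> z) \<le> c"
  proof -
    have "hyperbolic_density D z * cmod (deriv \<psi> 0) * cmod (deriv \<phi> z) \<le> 1 * cmod (deriv \<phi> z)"
      by (intro mult_right_mono hyperbolic_density_disc_map_le[OF D \<psi>]) auto
    then show ?thesis
      unfolding c_def using hyperbolic_density_pos[OF D] by (simp add: divide_simps mult_ac)
  qed
  moreover have "Sup S \<le> 1" using mem[of "1/2"] le by (intro cSup_least) auto
  ultimately show ?thesis by (simp add: rigidity_const2_def S_def)
qed

subsection \<open>Discs tangent to the boundary at a smooth boundary point\<close>

lemma C2_on_quadratic_expansion:
  fixes \<psi> :: "'a::real_normed_vector \<Rightarrow> real"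
  assumes U: "open U" "p \<in> U" and C2: "C2_on U \<psi>"
  obtains \<psi>' :: "'a \<Rightarrow> 'a \<Rightarrow>\<^sub>L real" and M e where "M > 0" "e > 0" "ball p e \<subseteq> U"
    "(\<psi> has_derivative \<psi>' p) (at p)"
    "\<And>q. q \<in> ball p e \<Longrightarrow> norm (\<psi>' p) \<le> 2 * norm (\<psi>' q)"
    "\<And>q x. q \<in> ball p e \<Longrightarrow> x \<in> ball p e \<Longrightarrow>
       \<bar>\<psi> x - \<psi> q - \<psi>' q (x - q)\<bar> \<le> M * (norm (x - q))\<^sup>2"
proof -
  obtain \<psi>' :: "'a \<Rightarrow> 'a \<Rightarrow>\<^sub>L real" and \<psi>'' :: "'a \<Rightarrow> 'a \<Rightarrow>\<^sub>L 'a \<Rightarrow>\<^sub>L real"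
    where d1: "\<And>x. x \<in> U \<Longrightarrow> (\<psi> has_derivative \<psi>' x) (at x)"
      and d2: "\<And>x. x \<in> U \<Longrightarrow> (\<psi>' has_derivative \<psi>'' x) (at x)"
      and c2: "continuous_on U \<psi>''"
    using C2 unfolding C2_on_def by blast
  define M where "M = norm (\<psi>'' p) + 1"
  have "isCont \<psi>'' p" using c2 U by (simp add: continuous_on_eq_continuous_at)
  then have "\<forall>\<^sub>F x in nhds p. dist (\<psi>'' x) (\<psi>'' p) < 1"
    by (intro tendstoD) (auto simp: isCont_def tendsto_nhds_iff)
  moreover have "isCont \<psi>' p" using has_derivative_continuous[OF d2[OF U(2)]] by simp
  then have "(\<psi>' \<longlongrightarrow> \<psi>' p) (nhds p)" by (simp add: isCont_def tendsto_nhds_iff)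
  from tendstoD[OF this, of "norm (\<psi>' p) / 2"]
  have "\<forall>\<^sub>F x in nhds p. \<psi>' p \<noteq> 0 \<longrightarrow> dist (\<psi>' x) (\<psi>' p) < norm (\<psi>' p) / 2"
    by (cases "\<psi>' p = 0") auto
  ultimately have "\<forall>\<^sub>F x in nhds p. x \<in> U \<and> dist (\<psi>'' x) (\<psi>'' p) < 1 \<and>
      (\<psi>' p \<noteq> 0 \<longrightarrow> dist (\<psi>' x) (\<psi>' p) < norm (\<psi>' p) / 2)"
    using eventually_nhds_in_open[OF U] by eventually_elim auto
  then obtain e where e: "e > 0" and E: "\<And>x. x \<in> ball p e \<Longrightarrow> x \<in> U"
      "\<And>x. x \<in> ball p e \<Longrightarrow> dist (\<psi>'' x) (\<psi>'' p) < 1"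
      "\<And>x. x \<in> ball p e \<Longrightarrow> \<psi>' p \<noteq> 0 \<Longrightarrow> dist (\<psi>' x) (\<psi>' p) < norm (\<psi>' p) / 2"
    unfolding eventually_nhds_metric by (metis dist_commute mem_ball)
  have nM: "norm (\<psi>'' x) \<le> M" if "x \<in> ball p e" for x
    using E(2)[OF that] norm_triangle_sub[of "\<psi>'' x" "\<psi>'' p"] by (simp add: M_def dist_norm)
  have lip: "norm (\<psi>' x - \<psi>' q) \<le> M * norm (x - q)" if "x \<in> ball p e" "q \<in> ball p e" for x q
    by (rule differentiable_bound[of "ball p e" \<psi>' "\<lambda>x. \<psi>'' x"])
      (use that E d2 nM in \<open>auto intro: has_derivative_at_withinI simp: norm_blinfun.rep_eq[symmetric]\<close>)
  show thesis
  proof (rule that[of M e \<psi>'])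
    show "norm (\<psi>' p) \<le> 2 * norm (\<psi>' q)" if "q \<in> ball p e" for q
      using E(3)[OF that] norm_triangle_ineq3[of "\<psi>' q" "\<psi>' p"] by (cases "\<psi>' p = 0") (auto simp: dist_norm)
    fix q x assume q: "q \<in> ball p e" and x: "x \<in> ball p e"
    define S where "S = ball p e \<inter> cball q (norm (x - q))"
    have "norm ((\<psi> x - \<psi>' q x) - (\<psi> q - \<psi>' q q)) \<le> (M * norm (x - q)) * norm (x - q)"
    proof (rule differentiable_bound[of S "\<lambda>x. \<psi> x - \<psi>' q x" "\<lambda>x v. \<psi>' x v - \<psi>' q v"])
      show "convex S" by (simp add: S_def convex_Int)
      fix y assume y: "y \<in> S"
      show "((\<lambda>x. \<psi> x - \<psi>' q x) has_derivative (\<lambda>v. \<psi>' y v - \<psi>' q v)) (at y within S)"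
        using y E(1) by (intro derivative_intros has_derivative_at_withinI[OF d1]
            bounded_linear_imp_has_derivative blinfun.bounded_linear_right) (auto simp: S_def)
      have "onorm (\<lambda>v. \<psi>' y v - \<psi>' q v) = norm (\<psi>' y - \<psi>' q)"
        by (simp add: norm_blinfun.rep_eq minus_blinfun.rep_eq)
      also have "\<dots> \<le> M * norm (y - q)" using lip y q by (simp add: S_def)
      also have "\<dots> \<le> M * norm (x - q)"
        using y by (intro mult_left_mono) (auto simp: S_def M_def dist_norm norm_minus_commute)
      finally show "onorm (\<lambda>v. \<psi>' y v - \<psi>' q v) \<le> M * norm (x - q)" .
    qed (use q x in \<open>auto simp: S_def dist_norm norm_minus_commute\<close>)
    then show "\<bar>\<psi> x - \<psi> q - \<psi>' q (x - q)\<bar> \<le> M * (norm (x - q))\<^sup>2"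
      by (simp add: blinfun.diff_right power2_eq_square algebra_simps)
  qed (use e d1 U E in \<open>auto simp: M_def add_nonneg_pos\<close>)
qed

lemma C2_boundary_tangent_balls:
  assumes bp: "C2_boundary_point D p"
  obtains r e where "r > 0" "e > 0"
    "\<And>q. q \<in> frontier D \<Longrightarrow> dist p q < e \<Longrightarrow>
       \<exists>n. cmod n = 1 \<and> ball (q - of_real r * n) r \<subseteq> D \<and> cball (q + of_real r * n) r \<inter> D = {}"
proof -
  obtain U and \<psi> :: "complex \<Rightarrow> real" where U: "open U" "p \<in> U" and C2: "C2_on U \<psi>"
    and D: "U \<inter> D = {z \<in> U. \<psi> z < 0}" and fr: "U \<inter> frontier D = {z \<in> U. \<psi> z = 0}"
    and nz: "\<forall>z \<in> U \<inter> frontier D. frechet_derivative \<psi> (at z) \<noteq> (\<lambda>_. 0)"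
    and p: "p \<in> frontier D"
    using bp unfolding C2_boundary_point_def by blast
  obtain \<psi>' :: "complex \<Rightarrow> complex \<Rightarrow>\<^sub>L real" and M e0 where M: "M > 0" and e0: "e0 > 0" "ball p e0 \<subseteq> U"
    and dp: "(\<psi> has_derivative \<psi>' p) (at p)"
    and low: "\<And>q. q \<in> ball p e0 \<Longrightarrow> norm (\<psi>' p) \<le> 2 * norm (\<psi>' q)"
    and ex: "\<And>q x. q \<in> ball p e0 \<Longrightarrow> x \<in> ball p e0 \<Longrightarrow>
       \<bar>\<psi> x - \<psi> q - \<psi>' q (x - q)\<bar> \<le> M * (norm (x - q))\<^sup>2"
    using C2_on_quadratic_expansion[OF U C2] by metis
  have "\<psi>' p \<noteq> 0"
  proof
    assume "\<psi>' p = 0"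
    then have "(\<psi> has_derivative (\<lambda>_. 0)) (at p)" using dp by (simp add: zero_blinfun.rep_eq)
    then show False using nz U p frechet_derivative_at[of \<psi> "\<lambda>_. 0" p] by auto
  qed
  define m where "m = norm (\<psi>' p) / 2"
  have m: "m > 0" "\<And>q. q \<in> ball p e0 \<Longrightarrow> m \<le> norm (\<psi>' q)"
  proof -
    show "m > 0" using \<open>\<psi>' p \<noteq> 0\<close> by (simp add: m_def)
    show "m \<le> norm (\<psi>' q)" if "q \<in> ball p e0" for q
      using low[OF that] by (simp add: m_def)
  qed
  define r where "r = min (m / (2 * M)) (e0 / 8)"
  have r: "r > 0" "r \<le> e0 / 8" "2 * r * M \<le> m"
  proof -
    have "r \<le> m / (2 * M)" by (simp add: r_def)
    then show "2 * r * M \<le> m" using M by (simp add: field_simps)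
  qed (use m M e0 in \<open>auto simp: r_def\<close>)
  show thesis
  proof (rule that[of r "e0 / 2"])
    fix q assume q: "q \<in> frontier D" "dist p q < e0 / 2"
    then have qb: "q \<in> ball p e0" using e0 by auto
    then have \<psi>q: "\<psi> q = 0" using q fr e0 by blast
    define g where "g = Complex (\<psi>' q 1) (\<psi>' q \<i>)"
    have g: "\<psi>' q v = g \<bullet> v" for v
    proof -
      have "v = Re v *\<^sub>R 1 + Im v *\<^sub>R \<i>" by (simp add: complex_eq_iff)
      then have "\<psi>' q v = Re v * \<psi>' q 1 + Im v * \<psi>' q \<i>"
        by (metis blinfun.add_right blinfun.scaleR_right real_scaleR_def)
      then show ?thesis by (simp add: g_def inner_complex_def mult.commute)
    qed
    have "norm (\<psi>' q) \<le> cmod g"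
      by (intro norm_blinfun_bound) (simp_all add: g Cauchy_Schwarz_ineq2)
    then have mg: "m \<le> cmod g" using m(2)[OF qb] by simp
    then have g0: "cmod g > 0" using m(1) by linarith
    define n where "n = g / of_real (cmod g)"
    have n: "cmod n = 1" using g0 by (simp add: n_def norm_divide)
    have gn: "g = cmod g *\<^sub>R n" using g0 by (simp add: n_def scaleR_conv_of_real)
    have exp: "\<bar>\<psi> x - cmod g * (n \<bullet> (x - q))\<bar> \<le> M * (norm (x - q))\<^sup>2" "x \<in> U"
      if "dist x q \<le> 2 * r" for x
    proof -
      have "dist p x < e0"
        using dist_triangle[of p x q] that q(2) r(1,2) e0(1) by (simp add: dist_commute)
      then show "x \<in> U" using e0(2) by auto
      have "\<psi>' q (x - q) = cmod g * (n \<bullet> (x - q))" unfolding g by (subst gn) simp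
      then show "\<bar>\<psi> x - cmod g * (n \<bullet> (x - q))\<bar> \<le> M * (norm (x - q))\<^sup>2"
        using ex[OF qb, of x] \<open>dist p x < e0\<close> \<psi>q by simp
    qed
    have sq: "(norm (v - s *\<^sub>R n))\<^sup>2 = (norm v)\<^sup>2 - 2 * s * (n \<bullet> v) + s\<^sup>2" for v s
    proof -
      have "(norm (v - s *\<^sub>R n))\<^sup>2 = (norm v)\<^sup>2 + (norm (s *\<^sub>R n))\<^sup>2 - 2 * (v \<bullet> (s *\<^sub>R n))"
        unfolding power2_norm_eq_inner by (simp add: inner_diff_left inner_diff_right inner_commute)
      then show ?thesis by (simp add: n inner_commute)
    qed
    have weak: "M * (norm v)\<^sup>2 \<le> cmod g * (norm v)\<^sup>2 / (2 * r)" for v :: complex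
    proof -
      have "2 * r * M * (norm v)\<^sup>2 \<le> cmod g * (norm v)\<^sup>2"
        using r(3) mg by (intro mult_right_mono) auto
      then show ?thesis using r(1) by (simp add: field_simps)
    qed
    have ext: "\<psi> x \<ge> 0 \<and> x \<in> U" if "dist (q + of_real r * n) x \<le> r" for x
    proof -
      have v: "norm ((x - q) - r *\<^sub>R n) \<le> r"
        using that by (simp add: dist_norm norm_minus_commute scaleR_conv_of_real algebra_simps)
      have nv: "dist x q \<le> 2 * r"
        using norm_triangle_sub[of "x - q" "r *\<^sub>R n"] v n r(1) by (simp add: dist_norm)
      have "(norm ((x - q) - r *\<^sub>R n))\<^sup>2 \<le> r\<^sup>2" using v by (simp add: power_mono)
      then have "(norm (x - q))\<^sup>2 \<le> 2 * r * (n \<bullet> (x - q))" unfolding sq by simp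
      then have "cmod g * (norm (x - q))\<^sup>2 \<le> cmod g * (2 * r * (n \<bullet> (x - q)))"
        by (rule mult_left_mono) simp
      then have "cmod g * (norm (x - q))\<^sup>2 / (2 * r) \<le> cmod g * (n \<bullet> (x - q))"
        using r(1) by (simp add: field_simps)
      then show ?thesis using exp[OF nv] weak[of "x - q"] by linarith
    qed
    have int: "\<psi> x < 0 \<and> x \<in> U" if "dist (q - of_real r * n) x < r" for x
    proof -
      have v: "norm ((x - q) - (- r) *\<^sub>R n) < r"
        using that by (simp add: dist_norm norm_minus_commute scaleR_conv_of_real algebra_simps)
      have nv: "dist x q \<le> 2 * r"
        using norm_triangle_sub[of "x - q" "(- r) *\<^sub>R n"] v n r(1) by (simp add: dist_norm)
      have "(norm ((x - q) - (- r) *\<^sub>R n))\<^sup>2 < r\<^sup>2" using v by (simp add: power_strict_mono)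
      then have "(norm (x - q))\<^sup>2 < - 2 * r * (n \<bullet> (x - q))" unfolding sq by simp
      then have "cmod g * (norm (x - q))\<^sup>2 < cmod g * (- 2 * r * (n \<bullet> (x - q)))"
        using g0 by (rule mult_strict_left_mono)
      then have "cmod g * (norm (x - q))\<^sup>2 / (2 * r) < - (cmod g * (n \<bullet> (x - q)))"
        using r(1) by (simp add: field_simps)
      then show ?thesis using exp[OF nv] weak[of "x - q"] by linarith
    qed
    have "ball (q - of_real r * n) r \<subseteq> D" using int D by auto
    moreover have "cball (q + of_real r * n) r \<inter> D = {}" using ext D by force
    ultimately show "\<exists>n. cmod n = 1 \<and> ball (q - of_real r * n) r \<subseteq> D \<and> cball (q + of_real r * n) r \<inter> D = {}"
      using n by blast
  qed (use r e0 in auto)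
qed

lemma le_dist_if_ball_cball_disjoint:
  fixes x y :: "'a::euclidean_space"
  assumes "ball x s \<inter> cball y t = {}" "s > 0" "t \<ge> 0"
  shows "s + t \<le> dist x y"
proof (rule ccontr)
  assume a: "\<not> ?thesis"
  have "x \<in> ball x s" "y \<in> cball y t" using assms by auto
  then have "x \<noteq> y" using assms(1) by blast
  define d where "d = dist x y"
  have d: "d < s + t" "d > 0" using a \<open>x \<noteq> y\<close> by (auto simp: d_def)
  define k where "k = min t d"
  define u where "u = y + (k / d) *\<^sub>R (x - y)"
  have "dist y u = k" using d assms by (auto simp: u_def d_def dist_norm norm_minus_commute k_def)
  moreover have "dist x u = d - k"
  proof -
    have "x - u = (1 - k / d) *\<^sub>R (x - y)" by (simp add: u_def algebra_simps)
    then have "dist x u = \<bar>1 - k / d\<bar> * d" by (simp add: dist_norm d_def)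
    also have "\<dots> = \<bar>(1 - k / d) * d\<bar>" using d by (simp add: abs_mult)
    also have "(1 - k / d) * d = d - k" using d by (simp add: field_simps)
    finally show ?thesis by (simp add: k_def)
  qed
  ultimately have "u \<in> ball x s \<inter> cball y t" using d assms(2,3) by (auto simp: k_def min_def)
  then show False using assms by blast
qed

text \<open>
  \<open>\<phi>\<close> maps the exterior of the outer tangent disc, and \<open>\<psi>\<close> the unit disc onto the inner
  tangent disc, at the boundary point \<open>q\<close> nearest to \<open>z\<close>.  With \<open>t = dist z q\<close> the product of
  their derivatives is \<open>(2 r - t) / (2 r + t)\<close>.
\<close>

lemma C2_boundary_disc_maps:
  assumes D: "open D" and bp: "C2_boundary_point D p"
  obtains r e where "r > 0" "e > 0" "e \<le> r"
    "\<And>z. z \<in> D \<Longrightarrow> dist z p < e \<Longrightarrow> \<exists>\<phi> \<psi>.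
       \<phi> holomorphic_on D \<and> \<phi> ` D \<subseteq> ball 0 1 \<and> \<phi> z = 0 \<and>
       \<psi> holomorphic_on ball 0 1 \<and> \<psi> ` ball 0 1 \<subseteq> D \<and> \<psi> 0 = z \<and>
       (2 * r - dist z p) / (2 * r + dist z p) \<le> cmod (deriv \<psi> 0) * cmod (deriv \<phi> z)"
proof -
  obtain r e where r: "r > 0" and e: "e > 0" and tan:
    "\<And>q. q \<in> frontier D \<Longrightarrow> dist p q < e \<Longrightarrow>
       \<exists>n. cmod n = 1 \<and> ball (q - of_real r * n) r \<subseteq> D \<and> cball (q + of_real r * n) r \<inter> D = {}"
    using C2_boundary_tangent_balls[OF bp] by metis
  have pf: "p \<in> frontier D" using bp by (simp add: C2_boundary_point_def)
  show thesis
  proof (rule that[of r "min r (e / 2)"])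
    fix z assume z: "z \<in> D" "dist z p < min r (e / 2)"
    obtain q where q: "q \<in> frontier D" "\<And>y. y \<in> frontier D \<Longrightarrow> dist z q \<le> dist z y"
      using distance_attains_inf[OF frontier_closed] pf by (metis empty_iff)
    define t where "t = dist z q"
    have t_le: "t \<le> dist z p" using q(2)[OF pf] by (simp add: t_def)
    have "q \<notin> D" using q(1) D by (simp add: frontier_def interior_open)
    then have t0: "t > 0" using z(1) by (auto simp: t_def)
    have tr: "t < r" using t_le z(2) by simp
    have "dist p q < e" using dist_triangle[of p q z] t_le z(2) by (simp add: t_def dist_commute)
    then obtain n where n: "cmod n = 1" "ball (q - of_real r * n) r \<subseteq> D"
        "cball (q + of_real r * n) r \<inter> D = {}"
      using tan[OF q(1)] by blast
    have "ball z t \<subseteq> D"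
    proof (rule ccontr)
      assume "\<not> ball z t \<subseteq> D"
      moreover have "z \<in> ball z t \<inter> D" using z t0 by simp
      ultimately have "ball z t \<inter> frontier D \<noteq> {}"
        by (intro connected_Int_frontier connected_ball) blast+
      then show False using q(2) by (force simp: t_def)
    qed
    then have "t + r \<le> dist z (q + of_real r * n)"
      using n(3) t0 r by (intro le_dist_if_ball_cball_disjoint) auto
    moreover have "dist z (q + of_real r * n) = cmod ((z - q) + (- (of_real r * n)))"
      by (simp add: dist_norm algebra_simps)
    moreover have nn: "cmod (z - q) = t" "cmod (- (of_real r * n)) = r"
      using n r by (auto simp: t_def dist_norm norm_mult)
    ultimately have eq: "cmod ((z - q) + (- (of_real r * n))) = cmod (z - q) + cmod (- (of_real r * n))"
      using norm_triangle_ineq[of "z - q" "- (of_real r * n)"] by simp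
    have "of_real t * (- (of_real r * n)) = of_real r * (z - q)"
      using iffD1[OF norm_triangle_eq eq] unfolding nn by (simp only: scaleR_conv_of_real)
    then have "of_real r * (z - q) = of_real r * (- (of_real t * n))" by (simp add: mult_ac)
    then have "z - q = - (of_real t * n)" using r by (subst (asm) mult_cancel_left) auto
    then have zq: "z = q - of_real t * n" by (simp add: diff_eq_eq)
    define ce ci where "ce = q + of_real r * n" and "ci = q - of_real r * n"
    have "z - ce = - (of_real (r + t) * n)" "z - ci = of_real (r - t) * n"
      by (simp_all add: zq ce_def ci_def algebra_simps)
    then have nce: "cmod (z - ce) = r + t" and nci: "cmod (z - ci) = r - t"
      using n(1) r t0 tr by (simp_all add: norm_mult del: of_real_add of_real_diff)
    have far: "cmod (u - ce) > r" if "u \<in> D" for u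
    proof -
      have "u \<notin> cball ce r" using n(3) that by (auto simp: ce_def)
      then show ?thesis by (simp add: dist_norm norm_minus_commute)
    qed
    have nn: "1 - cnj w * w = of_real (1 - (cmod w)\<^sup>2)" for w
      by (metis complex_norm_square mult.commute of_real_1 of_real_diff)
    define w0 where "w0 = of_real r / (z - ce)"
    have w0: "cmod w0 = r / (r + t)" using nce r by (simp add: w0_def norm_divide)
    have w01: "cmod w0 < 1" using w0 r t0 by simp
    define j where "j = (\<lambda>u. of_real r / (u - ce))"
    have j: "j holomorphic_on D" "j ` D \<subseteq> ball 0 1"
    proof -
      show "j holomorphic_on D" unfolding j_def using far r by (intro holomorphic_intros) force
      show "j ` D \<subseteq> ball 0 1" using far r by (force simp: j_def norm_divide divide_simps)
    qed
    define \<phi> where "\<phi> = Moebius_function 0 w0 \<circ> j"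
    have \<phi>: "\<phi> holomorphic_on D" "\<phi> ` D \<subseteq> ball 0 1" "\<phi> z = 0"
    proof -
      show "\<phi> holomorphic_on D"
        unfolding \<phi>_def by (rule holomorphic_on_compose_gen[OF j(1) Moebius_function_holomorphic[OF w01] j(2)])
      show "\<phi> ` D \<subseteq> ball 0 1" using j(2) Moebius_function_norm_lt_1[OF w01] by (force simp: \<phi>_def)
      show "\<phi> z = 0" by (simp add: \<phi>_def j_def w0_def Moebius_function_eq_zero)
    qed
    have "cmod (deriv \<phi> z) = r / (t * (2 * r + t))"
    proof -
      have zce: "z - ce \<noteq> 0" using nce r t0 by auto
      have p: "0 < 1 - (cmod w0)\<^sup>2" using w01 by (simp add: power_less_one_iff)
      then have "1 - cnj w0 * w0 \<noteq> 0" unfolding nn by (simp only: of_real_eq_0_iff)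
      from deriv_Moebius_function[OF this]
      have "(Moebius_function 0 w0 has_field_derivative (1 - cnj w0 * w0) / (1 - cnj w0 * w0)\<^sup>2) (at (j z))"
        by (simp add: j_def w0_def)
      moreover have "(j has_field_derivative - of_real r / (z - ce)\<^sup>2) (at z)"
        unfolding j_def using zce by (auto intro!: derivative_eq_intros simp: power2_eq_square)
      ultimately have "(\<phi> has_field_derivative
           (1 - cnj w0 * w0) / (1 - cnj w0 * w0)\<^sup>2 * (- of_real r / (z - ce)\<^sup>2)) (at z)"
        unfolding \<phi>_def by (rule DERIV_chain)
      then have "cmod (deriv \<phi> z) =
         cmod ((1 - cnj w0 * w0) / (1 - cnj w0 * w0)\<^sup>2 * (- of_real r / (z - ce)\<^sup>2))"
        by (simp add: DERIV_imp_deriv)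
      also have "\<dots> = 1 / (1 - (cmod w0)\<^sup>2) * (r / (r + t)\<^sup>2)"
        unfolding nn norm_mult norm_divide norm_power norm_of_real norm_minus_cancel nce abs_of_pos[OF p]
          abs_of_pos[OF r] using p by (simp add: power2_eq_square)
      also have "\<dots> = r / ((1 - (cmod w0)\<^sup>2) * (r + t)\<^sup>2)" by simp
      also have "(1 - (cmod w0)\<^sup>2) * (r + t)\<^sup>2 = t * (2 * r + t)"
      proof -
        have "(cmod w0)\<^sup>2 * (r + t)\<^sup>2 = r\<^sup>2" using r t0 by (simp add: w0 power_divide)
        then have "(1 - (cmod w0)\<^sup>2) * (r + t)\<^sup>2 = (r + t)\<^sup>2 - r\<^sup>2" by (simp add: left_diff_distrib)
        also have "\<dots> = t * (2 * r + t)" by algebra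
        finally show ?thesis .
      qed
      finally show ?thesis .
    qed
    moreover
    define w1 where "w1 = (z - ci) / of_real r"
    have w1: "cmod w1 = (r - t) / r" using nci r by (simp add: w1_def norm_divide)
    have w11: "cmod (- w1) < 1" using w1 r t0 by simp
    define \<psi> where "\<psi> = (\<lambda>v. ci + of_real r * Moebius_function 0 (- w1) v)"
    have \<psi>: "\<psi> holomorphic_on ball 0 1" "\<psi> ` ball 0 1 \<subseteq> D" "\<psi> 0 = z"
    proof -
      show "\<psi> holomorphic_on ball 0 1"
        unfolding \<psi>_def by (intro holomorphic_intros Moebius_function_holomorphic[OF w11])
      have "\<psi> v \<in> ball ci r" if "v \<in> ball 0 1" for v
        using Moebius_function_norm_lt_1[OF w11, of v 0] that r
        by (simp add: \<psi>_def dist_norm norm_mult)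
      then show "\<psi> ` ball 0 1 \<subseteq> D" using n(2) by (auto simp: ci_def)
      show "\<psi> 0 = z" using r by (simp add: \<psi>_def w1_def Moebius_function_of_zero)
    qed
    have "cmod (deriv \<psi> 0) = t * (2 * r - t) / r"
    proof -
      have "(Moebius_function 0 (- w1) has_field_derivative (1 - cnj w1 * w1)) (at 0)"
        using deriv_Moebius_function[of "- w1" 0] by simp
      then have "(\<psi> has_field_derivative of_real r * (1 - cnj w1 * w1)) (at 0)"
        unfolding \<psi>_def by (auto intro!: derivative_eq_intros)
      then have "cmod (deriv \<psi> 0) = cmod (of_real r * (1 - cnj w1 * w1))"
        by (simp add: DERIV_imp_deriv)
      also have "\<dots> = r * \<bar>1 - (cmod w1)\<^sup>2\<bar>"
        unfolding nn norm_mult norm_of_real using r by simp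
      also have "1 - (cmod w1)\<^sup>2 = t * (2 * r - t) / r\<^sup>2"
        using r by (simp add: w1 field_simps power2_eq_square)
      also have "\<bar>t * (2 * r - t) / r\<^sup>2\<bar> = t * (2 * r - t) / r\<^sup>2" using t0 tr by simp
      finally show ?thesis using r by (simp add: power2_eq_square)
    qed
    ultimately have "cmod (deriv \<psi> 0) * cmod (deriv \<phi> z) = (2 * r - t) / (2 * r + t)"
      using r t0 by simp
    moreover have "(2 * r - dist z p) / (2 * r + dist z p) \<le> (2 * r - t) / (2 * r + t)"
      using t_le t0 r z(2) by (intro frac_le) auto
    ultimately show "\<exists>\<phi> \<psi>. \<phi> holomorphic_on D \<and> \<phi> ` D \<subseteq> ball 0 1 \<and> \<phi> z = 0 \<and>
       \<psi> holomorphic_on ball 0 1 \<and> \<psi> ` ball 0 1 \<subseteq> D \<and> \<psi> 0 = z \<and>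
       (2 * r - dist z p) / (2 * r + dist z p) \<le> cmod (deriv \<psi> 0) * cmod (deriv \<phi> z)"
      using \<phi> \<psi> by (intro exI[of _ \<phi>] exI[of _ \<psi>]) auto
  qed (use r e in auto)
qed

subsection \<open>Boundary limits of the rigidity constants\<close>

theorem theorem1p2:
  fixes D D' :: "complex set" and p :: complex
  assumes "open D" and "connected D" and "bounded D" and "D \<noteq> {}"
    and "open D'" and "connected D'" and "bounded D'" and "D' \<noteq> {}"
    and "C2_boundary_point D p"
  shows "((\<lambda>z. rigidity_const D z) \<longlongrightarrow> 1) (at p within D) \<and>
         (\<forall>w\<in>D'. ((\<lambda>z. rigidity_const2 D D' z w) \<longlongrightarrow> 1) (at p within D))"
proof -
  obtain r e where r: "r > 0" and e: "e > 0" and maps: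
    "\<And>z. z \<in> D \<Longrightarrow> dist z p < e \<Longrightarrow> \<exists>\<phi> \<psi>.
       \<phi> holomorphic_on D \<and> \<phi> ` D \<subseteq> ball 0 1 \<and> \<phi> z = 0 \<and>
       \<psi> holomorphic_on ball 0 1 \<and> \<psi> ` ball 0 1 \<subseteq> D \<and> \<psi> 0 = z \<and>
       (2 * r - dist z p) / (2 * r + dist z p) \<le> cmod (deriv \<psi> 0) * cmod (deriv \<phi> z)"
    using C2_boundary_disc_maps[OF assms(1,9)] by metis
  have near: "\<forall>\<^sub>F z in at p within D. z \<in> D \<and> dist z p < e"
    using e by (auto simp: eventually_at)
  have "((\<lambda>z. (2 * r - dist z p) / (2 * r + dist z p)) \<longlongrightarrow> (2 * r - dist p p) / (2 * r + dist p p)) (at p within D)"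
    using r by (intro tendsto_intros) auto
  then have lim: "((\<lambda>z. (2 * r - dist z p) / (2 * r + dist z p)) \<longlongrightarrow> 1) (at p within D)"
    using r by simp
  have squeeze: "(F \<longlongrightarrow> 1) (at p within D)"
    if F: "\<And>z \<phi> \<psi>. z \<in> D \<Longrightarrow> \<phi> holomorphic_on D \<Longrightarrow> \<phi> ` D \<subseteq> ball 0 1 \<Longrightarrow> \<phi> z = 0 \<Longrightarrow>
       \<psi> holomorphic_on ball 0 1 \<Longrightarrow> \<psi> ` ball 0 1 \<subseteq> D \<Longrightarrow> \<psi> 0 = z \<Longrightarrow>
       F z \<in> {cmod (deriv \<psi> 0) * cmod (deriv \<phi> z)..1}" for F
  proof (rule tendsto_sandwich[OF _ _ lim tendsto_const])
    have *: "(2 * r - dist z p) / (2 * r + dist z p) \<le> F z \<and> F z \<le> 1" if z: "z \<in> D \<and> dist z p < e" for z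
    proof -
      obtain \<phi> \<psi> where m: "\<phi> holomorphic_on D" "\<phi> ` D \<subseteq> ball 0 1" "\<phi> z = 0"
        "\<psi> holomorphic_on ball 0 1" "\<psi> ` ball 0 1 \<subseteq> D" "\<psi> 0 = z"
        "(2 * r - dist z p) / (2 * r + dist z p) \<le> cmod (deriv \<psi> 0) * cmod (deriv \<phi> z)"
        using maps z by metis
      then show ?thesis using F[OF _ m(1-6)] z by auto
    qed
    show "\<forall>\<^sub>F z in at p within D. (2 * r - dist z p) / (2 * r + dist z p) \<le> F z"
      "\<forall>\<^sub>F z in at p within D. F z \<le> 1"
      using near by (eventually_elim, use * in blast)+
  qed
  show ?thesis
  proof (intro conjI ballI)
    show "((\<lambda>z. rigidity_const D z) \<longlongrightarrow> 1) (at p within D)"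
      by (rule squeeze) (rule rigidity_const_bounds[OF assms(1-3)])
    show "((\<lambda>z. rigidity_const2 D D' z w) \<longlongrightarrow> 1) (at p within D)" if "w \<in> D'" for w
      by (rule squeeze) (rule rigidity_const2_bounds[OF assms(1-3) _ assms(5-7) that])
  qed
qed

end
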